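(* Let $\alpha>0$ and let $F$ be a continuous distribution function supported on $[1,\infty)$ with $\overline{F}=1-F\in \mathrm{RV}_{-\alpha}$. Suppose that $\overline F$ and the generalized inverse $F^{\leftarrow}$ are continuous. Let $(X_i)_{i\ge 1}$ be i.i.d. with distribution function $F$, and let $\widehat\alpha_{n,\kappa_n^\star}$ be the PLFit estimator computed from $X_1,\dots,X_n$. Then $\widehat{\alpha}_{n,\kappa_n^\star}\to\alpha$ in probability as $n\to\infty$.
   Context: $\overline F\in\mathrm{RV}_{-\alpha}$ means $\lim_{t\to\infty}\overline F(tx)/\overline F(t)=x^{-\alpha}$ for every $x>0$. $F^{\leftarrow}(s)=\inf\{x\in(0,\infty):F(x)\ge s\}$ for $s\in(0,1)$, and $F^{\leftarrow}(0)$ is the left endpoint of the support, $F^{\leftarrow}(0)=\lim_{s\downarrow0}F^{\leftarrow}(s)\ge 1$; continuity of $F^{\leftarrow}$ means continuity on $[0,1)$. $X_{1:n}\le\dots\le X_{n:n}$ are the order statistics of $X_1,\dots,X_n$. For $1\le k\le n-1$, $$H_{n,k}=\frac1k\sum_{i=1}^k\log\frac{X_{n-k+i:n}}{X_{n-k:n}},\qquad \widehat\alpha_{n,k}=H_{n,k}^{-1},$$ $$D_{n,k}=\sup_{y\ge1}\Big|\frac1k\sum_{i=1}^k \mathbf 1_{(y,\infty)}\Big(\frac{X_{n-k+i:n}}{X_{n-k:n}}\Big)-y^{-\widehat\alpha_{n,k}}\Big|,$$ and $\kappa_n^\star=\operatorname{argmin}_{1\le k\le n-1}D_{n,k}$ (the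 smallest minimizer if it is not unique). The PLFit estimator of $\alpha$ is $\widehat\alpha_{n,\kappa_n^\star}$. *)

theory Defs
  imports "HOL-Probability.Probability"
begin

definition regularly_varying :: "real \<Rightarrow> (real \<Rightarrow> real) \<Rightarrow> bool" where
  "regularly_varying \<rho> G \<longleftrightarrow> (\<forall>x>0. ((\<lambda>t. G (t * x) / G t) \<longlongrightarrow> x powr \<rho>) at_top)"

text \<open>Generalized inverse, meaningful on \<open>{0..<1}\<close>. The value at \<open>0\<close> is the left endpoint of the
  support, obtained as the right-hand limit there.\<close>

definition quantile :: "(real \<Rightarrow> real) \<Rightarrow> real \<Rightarrow> real" where
  "quantile F s =
     (if s = 0 then Lim (at_right 0) (\<lambda>u. Inf {x. 0 < x \<and> u \<le> F x})
      else Inf {x. 0 < x \<and> s \<le> F x})"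

text \<open>In the following, a realization of the sample is a sequence \<open>x 1, x 2, \<dots>\<close>; the value \<open>x 0\<close> is
  never used. The statistics are meaningful for \<open>1 \<le> k\<close>, \<open>k \<le> n - 1\<close>, and \<open>order_stat x n j\<close>
  (the \<open>j\<close>-th smallest of \<open>x 1, \<dots>, x n\<close>) for \<open>1 \<le> j\<close>, \<open>j \<le> n\<close>.\<close>

definition order_stat :: "(nat \<Rightarrow> real) \<Rightarrow> nat \<Rightarrow> nat \<Rightarrow> real" where
  "order_stat x n j = sort (map x [1..<Suc n]) ! (j - 1)"

definition hill_H :: "(nat \<Rightarrow> real) \<Rightarrow> nat \<Rightarrow> nat \<Rightarrow> real" where
  "hill_H x n k =
     1 / real k * (\<Sum>i=1..k. ln (order_stat x n (n - k + i) / order_stat x n (n - k)))"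

text \<open>Division by zero gives \<open>alpha_hat x n k = 0\<close> when \<open>hill_H x n k = 0\<close>; for positive data this
  requires ties in the sample.\<close>

definition alpha_hat :: "(nat \<Rightarrow> real) \<Rightarrow> nat \<Rightarrow> nat \<Rightarrow> real" where
  "alpha_hat x n k = inverse (hill_H x n k)"

definition KS_dist :: "(nat \<Rightarrow> real) \<Rightarrow> nat \<Rightarrow> nat \<Rightarrow> real" where
  "KS_dist x n k =
     (SUP y\<in>{1..}.
        \<bar>1 / real k * (\<Sum>i=1..k. indicator {y<..} (order_stat x n (n - k + i) / order_stat x n (n - k)))
         - y powr (- alpha_hat x n k)\<bar>)"

definition kappa_star :: "(nat \<Rightarrow> real) \<Rightarrow> nat \<Rightarrow> nat" where
  "kappa_star x n = (LEAST k. is_arg_min (KS_dist x n) (\<lambda>k. k \<in> {1..n - 1}) k)"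

definition PLFit :: "(nat \<Rightarrow> real) \<Rightarrow> nat \<Rightarrow> real" where
  "PLFit x n = alpha_hat x n (kappa_star x n)"

text \<open>Measurability is part of the definition because \<open>measure\<close> is \<open>0\<close> on non-measurable sets. It is
  required only eventually, so that finitely many undefined initial terms (such as the PLFit
  estimator for \<open>n < 2\<close>) do not matter.\<close>

definition tendsto_in_probability ::
    "'a measure \<Rightarrow> (nat \<Rightarrow> 'a \<Rightarrow> real) \<Rightarrow> real \<Rightarrow> bool" where
  "tendsto_in_probability M Y c \<longleftrightarrow>
     (\<forall>\<^sub>F n in sequentially. Y n \<in> borel_measurable M) \<and>
     (\<forall>\<epsilon>>0. (\<lambda>n. measure M {\<omega> \<in> space M. \<bar>Y n \<omega> - c\<bar> > \<epsilon>}) \<longlonglongrightarrow> 0)"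

end

theory Submission
  imports Defs
begin

text \<open>
  Write \<open>G = 1 - F\<close>, and for a realization let \<open>N t\<close> be the number of sample points above \<open>t\<close>. With
  \<open>u = order_stat x n (n - k)\<close>, the empirical tail that \<open>KS_dist x n k\<close> compares with a power
  function is \<open>\<lambda>y. N (y * u) / k\<close>. Two facts about it decide everything.

  \<^item> \<^emph>\<open>Uniform relative closeness.\<close> Uniformly in \<open>n\<close> and with probability close to one, \<open>N t\<close> has a
    small relative distance to \<open>n * G t\<close> for all \<open>t\<close> at once for which \<open>n * G t\<close> exceeds a constant
    (\<open>uniformly_close_prob\<close>). By monotonicity it is enough to control \<open>N\<close> at points where \<open>G\<close> runs
    through a geometric sequence, and there the probabilities in Chebyshev's inequality sum to a
    geometric series. Hence \<open>N (y * u) / k\<close> is close to \<open>G (y * u) / G u\<close> for all \<open>y \<ge> 1\<close>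
    and all \<open>k\<close> above a constant (\<open>uniformly_close_ratio\<close>).

  \<^item> \<^emph>\<open>Identification.\<close> If \<open>G (y * u) / G u\<close> is uniformly close to \<open>y powr - a\<close> for one \<open>u \<ge> 1\<close>, then \<open>a\<close>
    is close to \<open>\<alpha>\<close>, whatever \<open>u\<close> is (\<open>index_identified\<close>). For large \<open>u\<close> this is regular
    variation. On bounded ranges of \<open>u\<close> it is compactness: in the limit \<open>G\<close> would be exactly a power
    beyond some point, and regular variation forces the exponent of that power to be \<open>\<alpha>\<close>.

  It follows that any random \<open>k\<close> which is large and has small \<open>KS_dist x n k\<close> has \<open>alpha_hat x n k\<close>
  close to \<open>\<alpha>\<close>. The minimizer \<open>kappa_star\<close> is of this kind. The empirical tail jumps by at least
  \<open>1 / k\<close> whereas a power function is continuous, so \<open>KS_dist x n k \<ge> 1 / (2 * k)\<close>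
  (\<open>KS_dist_ge_jump\<close>), and a small minimum implies a large minimizer. The minimum is small because
  one particular \<open>k\<close> achieves a small distance (\<open>small_KS_prob\<close>): take the points above a fixed high
  level \<open>t0\<close>. There the empirical tail is nearly \<open>y powr - \<alpha>\<close>, and the Hill statistic is nearly \<open>1 / \<alpha>\<close>
  since it is the integral of the empirical tail against \<open>dy / y\<close>, the contribution of very
  large \<open>y\<close> being controlled by Markov's inequality and the doubling bound for \<open>G\<close>.

  The Hill statistic itself is analysed at this one \<open>k\<close> only; at the minimizer the exponent is read off
  from the quality of the fit.
\<close>

section \<open>Order statistics and counts of exceedances\<close>

lemma sum_order_stat:
  fixes f :: "real \<Rightarrow> real"
  shows "(\<Sum>j=1..n. f (order_stat x n j)) = (\<Sum>i=1..n. f (x i))"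
proof -
  let ?ys = "sort (map x [1..<Suc n])"
  have "(\<Sum>j=1..n. f (order_stat x n j)) = (\<Sum>j<n. f (?ys ! j))"
    unfolding order_stat_def
    by (rule sum.reindex_bij_witness[of _ Suc "\<lambda>j. j - 1"]) auto
  also have "\<dots> = sum_list (map f ?ys)"
    by (simp add: sum_list_sum_nth atLeast0LessThan del: upt_Suc)
  also have "\<dots> = sum_mset (image_mset f (mset ?ys))"
    by (metis mset_map sum_mset_sum_list)
  also have "\<dots> = sum_list (map f (map x [1..<Suc n]))"
    by (metis mset_map mset_sort sum_mset_sum_list)
  also have "\<dots> = (\<Sum>i=1..n. f (x i))"
    by (simp add: interv_sum_list_conv_sum_set_nat atLeastLessThanSuc_atLeastAtMost comp_def del: upt_Suc)
  finally show ?thesis .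
qed

lemma order_stat_mono:
  assumes "1 \<le> i" "i \<le> j" "j \<le> n"
  shows "order_stat x n i \<le> order_stat x n j"
  unfolding order_stat_def using assms by (intro sorted_nth_mono) (auto simp del: upt_Suc)

lemma order_stat_in_sample:
  assumes "1 \<le> j" "j \<le> n"
  shows "\<exists>i\<in>{1..n}. order_stat x n j = x i"
proof -
  have "order_stat x n j \<in> set (sort (map x [1..<Suc n]))"
    unfolding order_stat_def using assms by (intro nth_mem) (simp del: upt_Suc)
  then show ?thesis by (auto simp del: upt_Suc)
qed

text \<open>
  Order statistics are translated into counts, which are sums of indicators and therefore accessible
  to measurability and to moment computations.
\<close>

lemma order_stat_le_iff:
  assumes "1 \<le> j" "j \<le> n"
  shows "order_stat x n j \<le> c \<longleftrightarrow> real j \<le> (\<Sum>i=1..n. indicator {..c} (x i))"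
proof -
  let ?S = "{i\<in>{1..n}. order_stat x n i \<le> c}"
  have "(\<Sum>i=1..n. indicator {..c} (x i)) = (\<Sum>j=1..n. indicator {..c} (order_stat x n j) :: real)"
    by (rule sum_order_stat[symmetric])
  also have "\<dots> = real (card ?S)"
    by (simp add: indicator_def sum.If_cases Int_def)
  finally have eq: "(\<Sum>i=1..n. indicator {..c} (x i)) = real (card ?S)" .
  show ?thesis
  proof
    assume "order_stat x n j \<le> c"
    then have "{1..j} \<subseteq> ?S" using assms order_stat_mono[of _ j n x] by fastforce
    then have "card {1..j} \<le> card ?S" by (intro card_mono) auto
    then have "real j \<le> real (card ?S)" by simp
    then show "real j \<le> (\<Sum>i=1..n. indicator {..c} (x i))" by (simp only: eq)
  next
    assume *: "real j \<le> (\<Sum>i=1..n. indicator {..c} (x i))"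
    show "order_stat x n j \<le> c"
    proof (rule ccontr)
      assume "\<not> order_stat x n j \<le> c"
      then have "?S \<subseteq> {1..<j}" using assms order_stat_mono[of j _ n x]
        by (force simp: not_less[symmetric])
      then have "card ?S \<le> card {1..<j}" by (intro card_mono) auto
      moreover have "j \<le> card ?S" using * by (simp only: eq of_nat_le_iff)
      ultimately show False using assms by simp
    qed
  qed
qed

definition exceed :: "(nat \<Rightarrow> real) \<Rightarrow> nat \<Rightarrow> real \<Rightarrow> real" where
  "exceed x n t = (\<Sum>i=1..n. indicator {t<..} (x i))"

text \<open>
  The left-continuous companion of \<open>exceed\<close>. At \<open>u = order_stat x n (n - k)\<close> the number \<open>k\<close> lies between
  \<open>exceed x n u\<close> and \<open>reach x n u\<close>, so that bounds on both counts cover samples with ties as well.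
\<close>

definition reach :: "(nat \<Rightarrow> real) \<Rightarrow> nat \<Rightarrow> real \<Rightarrow> real" where
  "reach x n t = (\<Sum>i=1..n. indicator {t..} (x i))"

lemma exceed_le_reach: "exceed x n t \<le> reach x n t"
  unfolding exceed_def reach_def by (intro sum_mono) (auto simp: indicator_def)

lemma exceed_antimono: "s \<le> t \<Longrightarrow> exceed x n t \<le> exceed x n s"
  unfolding exceed_def by (intro sum_mono) (auto simp: indicator_def)

lemma reach_antimono: "s \<le> t \<Longrightarrow> reach x n t \<le> reach x n s"
  unfolding reach_def by (intro sum_mono) (auto simp: indicator_def)

lemma reach_le_exceed: "s < t \<Longrightarrow> reach x n t \<le> exceed x n s"
  unfolding exceed_def reach_def by (intro sum_mono) (auto simp: indicator_def)

lemma exceed_nonneg: "0 \<le> exceed x n t"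
  unfolding exceed_def by (intro sum_nonneg) auto

lemma reach_le: "reach x n t \<le> real n"
proof -
  have "reach x n t \<le> (\<Sum>i=1..n. 1)"
    unfolding reach_def by (intro sum_mono) (auto simp: indicator_def)
  then show ?thesis by simp
qed

lemma exceed_eq_card: "exceed x n t = real (card {i\<in>{1..n}. t < x i})"
  by (simp add: exceed_def indicator_def sum.If_cases Int_def)

lemma order_stat_le_iff_exceed:
  assumes "1 \<le> j" "j \<le> n"
  shows "order_stat x n j \<le> c \<longleftrightarrow> exceed x n c \<le> real (n - j)"
proof -
  have "(\<Sum>i=1..n. indicator {..c} (x i)) + exceed x n c = (\<Sum>i=1..n. 1)"
    unfolding exceed_def sum.distrib[symmetric] by (intro sum.cong) (auto simp: indicator_def)
  then show ?thesis using order_stat_le_iff[OF assms, of x c] assms by (auto simp: of_nat_diff)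
qed

lemma exceed_order_stat_le:
  assumes "1 \<le> k" "k \<le> n - 1"
  shows "exceed x n (order_stat x n (n - k)) \<le> real k"
proof -
  have "exceed x n (order_stat x n (n - k)) \<le> real (n - (n - k))"
    using assms by (subst order_stat_le_iff_exceed[symmetric]) auto
  then show ?thesis using assms by simp
qed

lemma le_reach_order_stat:
  assumes "1 \<le> k" "k \<le> n - 1"
  shows "real k \<le> reach x n (order_stat x n (n - k))"
proof -
  let ?u = "order_stat x n (n - k)"
  have "real k = (\<Sum>j=n-k+1..n. 1)" using assms by (simp add: of_nat_diff)
  also have "\<dots> \<le> (\<Sum>j=n-k+1..n. indicator {?u..} (order_stat x n j))"
    using assms by (intro sum_mono) (auto simp: indicator_def intro!: order_stat_mono)
  also have "\<dots> \<le> (\<Sum>j=1..n. indicator {?u..} (order_stat x n j))"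
    by (intro sum_mono2) auto
  also have "\<dots> = reach x n ?u"
    unfolding reach_def by (rule sum_order_stat)
  finally show ?thesis .
qed

text \<open>
  The summands of a function vanishing up to \<open>order_stat x n (n - k)\<close> are supported on the top \<open>k\<close> points,
  so the sum over the top points, whose positions are random, equals a sum over the whole sample.
\<close>

lemma sum_top_order_stat:
  fixes f :: "real \<Rightarrow> real"
  assumes "1 \<le> k" "k \<le> n - 1"
    and zero: "\<And>v. v \<le> order_stat x n (n - k) \<Longrightarrow> f v = 0"
  shows "(\<Sum>i=1..k. f (order_stat x n (n - k + i))) = (\<Sum>i=1..n. f (x i))"
proof -
  have "(\<Sum>i=1..k. f (order_stat x n (n - k + i))) = (\<Sum>j=n-k+1..n. f (order_stat x n j))"
    using assms
    by (intro sum.reindex_bij_witness[of _ "\<lambda>j. j - (n - k)" "\<lambda>i. n - k + i"]) auto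
  also have "\<dots> = (\<Sum>j=1..n. f (order_stat x n j))"
    using assms by (intro sum.mono_neutral_left) (auto intro!: zero order_stat_mono)
  also have "\<dots> = (\<Sum>i=1..n. f (x i))" by (rule sum_order_stat)
  finally show ?thesis .
qed

lemma order_stat_ge:
  assumes "1 \<le> j" "j \<le> n" "\<And>i. i \<in> {1..n} \<Longrightarrow> c \<le> x i"
  shows "c \<le> order_stat x n j"
  using order_stat_in_sample[OF assms(1,2), of x] assms(3) by auto

section \<open>The Hill statistic and the Kolmogorov-Smirnov distance of a realization\<close>

lemma KS_tail_eq:
  assumes "1 \<le> k" "k \<le> n - 1" "0 < order_stat x n (n - k)" "1 \<le> y"
  shows "1 / real k * (\<Sum>i=1..k. indicator {y<..} (order_stat x n (n - k + i) / order_stat x n (n - k)))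
     = exceed x n (y * order_stat x n (n - k)) / real k"
proof -
  let ?u = "order_stat x n (n - k)"
  have "(\<Sum>i=1..k. indicator {y<..} (order_stat x n (n - k + i) / ?u)) =
        (\<Sum>i=1..k. (\<lambda>v. indicator {y * ?u<..} v :: real) (order_stat x n (n - k + i)))"
    using assms by (intro sum.cong) (auto simp: indicator_def field_simps)
  also have "\<dots> = exceed x n (y * ?u)"
    unfolding exceed_def using assms
  proof (intro sum_top_order_stat)
    fix v assume "v \<le> ?u"
    moreover have "?u \<le> y * ?u" using assms by simp
    ultimately show "indicator {y * ?u<..} v = (0::real)" by (auto simp: indicator_def)
  qed auto
  finally show ?thesis by simp
qed

lemma hill_H_eq:
  assumes "1 \<le> k" "k \<le> n - 1" "0 < order_stat x n (n - k)"
    and pos: "\<And>i. i \<in> {1..n} \<Longrightarrow> 0 < x i"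
  shows "hill_H x n k = 1 / real k * (\<Sum>i=1..n. max 0 (ln (x i / order_stat x n (n - k))))"
proof -
  let ?u = "order_stat x n (n - k)"
  let ?f = "\<lambda>v. if v \<le> ?u then 0 else ln (v / ?u)"
  have "(\<Sum>i=1..k. ln (order_stat x n (n - k + i) / ?u)) = (\<Sum>i=1..k. ?f (order_stat x n (n - k + i)))"
  proof (intro sum.cong refl)
    fix i assume "i \<in> {1..k}"
    then have "?u \<le> order_stat x n (n - k + i)" using assms by (intro order_stat_mono) auto
    then show "ln (order_stat x n (n - k + i) / ?u) = ?f (order_stat x n (n - k + i))"
      using assms by auto
  qed
  also have "\<dots> = (\<Sum>i=1..n. ?f (x i))"
    using assms by (intro sum_top_order_stat) auto
  also have "\<dots> = (\<Sum>i=1..n. max 0 (ln (x i / ?u)))"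
    using assms(3) pos by (intro sum.cong) (auto simp: max_def ln_ge_zero_iff field_simps)
  finally show ?thesis by (simp add: hill_H_def)
qed

lemma hill_H_nonneg:
  assumes "1 \<le> k" "k \<le> n - 1" "\<And>i. i \<in> {1..n} \<Longrightarrow> 0 < x i"
  shows "0 \<le> hill_H x n k"
proof -
  have "\<exists>i\<in>{1..n}. order_stat x n (n - k) = x i" using assms by (intro order_stat_in_sample) auto
  then have "0 < order_stat x n (n - k)" using assms by auto
  moreover have "0 \<le> (\<Sum>i=1..n. max 0 (ln (x i / order_stat x n (n - k))))"
    by (intro sum_nonneg) simp
  ultimately show ?thesis using hill_H_eq[OF assms(1,2) _ assms(3)] by simp
qed

text \<open>
  The supremum of a set of reals has its intended meaning only if the set is bounded; for the
  Kolmogorov-Smirnov distance this amounts to a nonnegative exponent.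
\<close>

lemma bdd_above_tail_diff:
  assumes "0 \<le> a" and "\<And>y. y \<in> Y \<Longrightarrow> 1 \<le> (y::real)"
    and "\<And>y. y \<in> Y \<Longrightarrow> 0 \<le> p y" "\<And>y. y \<in> Y \<Longrightarrow> p y \<le> 1"
  shows "bdd_above ((\<lambda>y. \<bar>p y - y powr - a\<bar>) ` Y)"
proof (rule bdd_aboveI2[where M = 1])
  fix y assume "y \<in> Y"
  then have "1 \<le> y" "0 \<le> p y" "p y \<le> 1" using assms by auto
  moreover have "y powr - a \<le> 1" using \<open>1 \<le> y\<close> assms(1)
    using powr_mono[of "-a" 0 y] by simp
  ultimately show "\<bar>p y - y powr - a\<bar> \<le> 1" by (smt (verit) powr_ge_zero)
qed

lemma KS_frac_bounds:
  "0 \<le> 1 / real k * (\<Sum>i=1..k. indicator {y<..} (r i))" "1 / real k * (\<Sum>i=1..k. indicator {y<..} (r i)) \<le> (1::real)"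
proof -
  have "(\<Sum>i=1..k. indicator {y<..} (r i)) \<le> (\<Sum>i=1..k. 1 :: real)"
    by (intro sum_mono) (auto simp: indicator_def)
  then show "1 / real k * (\<Sum>i=1..k. indicator {y<..} (r i)) \<le> (1::real)"
    by (cases "k = 0") (auto simp: field_simps)
qed (auto intro!: divide_nonneg_nonneg sum_nonneg)

lemma KS_dist_ge:
  assumes k: "1 \<le> k" "k \<le> n - 1" and pos: "\<And>i. i \<in> {1..n} \<Longrightarrow> 0 < x i" and "1 \<le> y"
  shows "\<bar>exceed x n (y * order_stat x n (n - k)) / real k - y powr (- alpha_hat x n k)\<bar> \<le> KS_dist x n k"
proof -
  have "\<exists>i\<in>{1..n}. order_stat x n (n - k) = x i" using k by (intro order_stat_in_sample) auto
  then have u: "0 < order_stat x n (n - k)" using pos by auto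
  have "0 \<le> alpha_hat x n k" using hill_H_nonneg[OF k pos] by (simp add: alpha_hat_def)
  then show ?thesis unfolding KS_dist_def KS_tail_eq[OF k u \<open>1 \<le> y\<close>, symmetric]
    using \<open>1 \<le> y\<close> by (intro cSUP_upper bdd_above_tail_diff KS_frac_bounds) auto
qed

lemma KS_dist_le:
  assumes k: "1 \<le> k" "k \<le> n - 1" and pos: "0 < order_stat x n (n - k)"
    and "\<And>y. 1 \<le> y \<Longrightarrow> \<bar>exceed x n (y * order_stat x n (n - k)) / real k - y powr (- alpha_hat x n k)\<bar> \<le> d"
  shows "KS_dist x n k \<le> d"
  unfolding KS_dist_def
proof (rule cSUP_least)
  fix y :: real assume "y \<in> {1..}"
  then have "1 \<le> y" by simp
  from assms(4)[OF this]
  show "\<bar>1 / real k * (\<Sum>i=1..k. indicator {y<..} (order_stat x n (n - k + i) / order_stat x n (n - k)))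
         - y powr (- alpha_hat x n k)\<bar> \<le> d"
    by (simp only: KS_tail_eq[OF k pos \<open>1 \<le> y\<close>])
qed auto

text \<open>
  Let \<open>m\<close> be the largest ratio. The empirical tail vanishes at \<open>m\<close> but is at least \<open>1 / k\<close> immediately to
  the left of \<open>m\<close>, while \<open>m powr - a\<close> is one number: it is at distance \<open>1 / (2 * k)\<close> or more from one of the
  two. If \<open>m = 1\<close>, there is no left neighbourhood inside \<open>{1..}\<close>, but then the empirical tail is \<open>0\<close> where
  the power function is \<open>1\<close>.
\<close>

lemma KS_dist_ge_jump:
  assumes k: "1 \<le> k" "k \<le> n - 1" and pos: "\<And>i. i \<in> {1..n} \<Longrightarrow> 0 < x i"
  shows "1 / (2 * real k) \<le> KS_dist x n k"
proof -
  define u where "u = order_stat x n (n - k)"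
  define m where "m = order_stat x n n / u"
  define a where "a = alpha_hat x n k"
  have "\<exists>i\<in>{1..n}. u = x i" unfolding u_def using k by (intro order_stat_in_sample) auto
  then have u: "0 < u" using pos by auto
  have mu: "m * u = order_stat x n n" using u by (simp add: m_def)
  have m1: "1 \<le> m" unfolding m_def using u k by (simp add: u_def order_stat_mono)
  have "exceed x n (m * u) \<le> 0"
    using order_stat_le_iff_exceed[of n n x "m * u"] k by (simp add: mu)
  then have ex0: "exceed x n (m * u) = 0" using exceed_nonneg[of x n "m * u"] by simp
  have D0: "m powr - a \<le> KS_dist x n k"
    using KS_dist_ge[of k n x m] k pos m1 by (simp add: ex0 a_def u_def[symmetric])
  show ?thesis
  proof (cases "m = 1")
    case True
    then have "1 \<le> KS_dist x n k" using D0 by simp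
    moreover have "1 / (2 * real k) \<le> 1" using k by (simp add: field_simps)
    ultimately show ?thesis by linarith
  next
    case False
    then have "1 < m" using m1 by simp
    have "((\<lambda>y. 1 / real k - y powr - a) \<longlongrightarrow> 1 / real k - m powr - a) (at_left m)"
      using \<open>1 < m\<close> by (intro tendsto_intros) auto
    moreover have "eventually (\<lambda>y. 1 / real k - y powr - a \<le> KS_dist x n k) (at_left m)"
      using eventually_at_left_real[OF \<open>1 < m\<close>]
    proof eventually_elim
      case (elim y)
      then have "y * u < order_stat x n n" using u by (simp add: mu[symmetric])
      then have "\<not> exceed x n (y * u) \<le> 0"
        using order_stat_le_iff_exceed[of n n x "y * u"] k by simp
      then have "1 \<le> exceed x n (y * u)" by (simp add: exceed_eq_card del: of_nat_le_0_iff card_eq_0_iff)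
      then have "1 / real k \<le> exceed x n (y * u) / real k" by (simp add: divide_right_mono)
      then show ?case using KS_dist_ge[of k n x y] k pos elim by (simp add: a_def u_def[symmetric])
    qed
    ultimately have "1 / real k - m powr - a \<le> KS_dist x n k"
      by (intro tendsto_upperbound) auto
    then show ?thesis using D0 by (simp add: field_simps)
  qed
qed

lemma kappa_star_props:
  assumes "2 \<le> n"
  shows "kappa_star x n \<in> {1..n-1}" "\<And>k. k \<in> {1..n-1} \<Longrightarrow> KS_dist x n (kappa_star x n) \<le> KS_dist x n k"
proof -
  have "\<exists>k. is_arg_min (KS_dist x n) (\<lambda>k. k \<in> {1..n - 1}) k"
    using ex_is_arg_min_if_finite[of "{1..n-1}" "KS_dist x n"] assms by auto
  then have "is_arg_min (KS_dist x n) (\<lambda>k. k \<in> {1..n - 1}) (kappa_star x n)"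
    unfolding kappa_star_def by (rule LeastI_ex)
  then show "kappa_star x n \<in> {1..n-1}" "\<And>k. k \<in> {1..n-1} \<Longrightarrow> KS_dist x n (kappa_star x n) \<le> KS_dist x n k"
    by (auto simp: is_arg_min_def not_less)
qed

section \<open>Measurability of the estimator\<close>

lemma order_stat_measurable:
  assumes X: "\<And>i. i \<in> {1..n} \<Longrightarrow> X i \<in> borel_measurable M" and j: "1 \<le> j" "j \<le> n"
  shows "(\<lambda>\<omega>. order_stat (\<lambda>i. X i \<omega>) n j) \<in> borel_measurable M"
proof (subst borel_measurable_iff_le, intro allI)
  fix c
  have "{\<omega> \<in> space M. order_stat (\<lambda>i. X i \<omega>) n j \<le> c}
      = {\<omega> \<in> space M. real j \<le> (\<Sum>i=1..n. indicator {..c} (X i \<omega>))}"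
    by (simp only: order_stat_le_iff[OF j])
  also have "\<dots> \<in> sets M"
    using X by measurable
  finally show "{\<omega> \<in> space M. order_stat (\<lambda>i. X i \<omega>) n j \<le> c} \<in> sets M" .
qed

lemma alpha_hat_measurable:
  assumes "\<And>i. i \<in> {1..n} \<Longrightarrow> X i \<in> borel_measurable M" and k: "k \<in> {1..n-1}"
  shows "(\<lambda>\<omega>. alpha_hat (\<lambda>i. X i \<omega>) n k) \<in> borel_measurable M"
proof -
  have [measurable]: "(\<lambda>\<omega>. order_stat (\<lambda>i. X i \<omega>) n j) \<in> borel_measurable M" if "1 \<le> j" "j \<le> n" for j
    using assms that by (intro order_stat_measurable) auto
  have [measurable]: "(\<lambda>\<omega>. order_stat (\<lambda>i. X i \<omega>) n (n - k + i)) \<in> borel_measurable M"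
    if "i \<in> {1..k}" for i
  proof -
    have "1 \<le> n - k + i" "n - k + i \<le> n" using that k by auto
    then show ?thesis by measurable
  qed
  have [measurable]: "(\<lambda>\<omega>. order_stat (\<lambda>i. X i \<omega>) n (n - k)) \<in> borel_measurable M"
  proof -
    have "1 \<le> n - k" "n - k \<le> n" using k by auto
    then show ?thesis by measurable
  qed
  show ?thesis unfolding alpha_hat_def hill_H_def by measurable
qed

text \<open>
  The estimator has to be measurable on the whole sample space, including the null set of samples with
  negative points. There the exponent may be negative and the set defining the Kolmogorov-Smirnov
  distance unbounded; its supremum is then an unspecified number, but always the same one.
\<close>

lemma Sup_not_bdd_above:
  fixes S T :: "real set"
  assumes "\<not> bdd_above S" "\<not> bdd_above T"
  shows "Sup S = Sup T"
proof -
  have "(\<lambda>z. \<forall>x\<in>S. x \<le> z) = (\<lambda>z. \<forall>x\<in>T. x \<le> z)"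
    using assms by (fastforce simp: bdd_above_def)
  then show ?thesis by (simp only: Sup_real_def)
qed

text \<open>
  Replaces the uncountable supremum in the Kolmogorov-Smirnov distance by a countable one. Right
  continuity is what the empirical tail offers, and it suffices because rationals accumulate at every
  point from the right.
\<close>

lemma SUP_rat_right_continuous:
  fixes g :: "real \<Rightarrow> real"
  assumes bdd: "bdd_above (g ` {1..})" and cont: "\<And>y. 1 \<le> y \<Longrightarrow> (g \<longlongrightarrow> g y) (at_right y)"
  shows "(SUP y\<in>{1..}. g y) = (SUP y\<in>{1..} \<inter> \<rat>. g y)"
proof (rule antisym)
  have bdd': "bdd_above (g ` ({1..} \<inter> \<rat>))" using bdd by (rule bdd_above_mono) auto
  show "(SUP y\<in>{1..}. g y) \<le> (SUP y\<in>{1..} \<inter> \<rat>. g y)"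
  proof (rule cSUP_least)
    fix y :: real assume "y \<in> {1..}"
    then have y: "1 \<le> y" by simp
    show "g y \<le> (SUP y\<in>{1..} \<inter> \<rat>. g y)"
    proof (rule ccontr)
      assume "\<not> g y \<le> (SUP y\<in>{1..} \<inter> \<rat>. g y)"
      then have "eventually (\<lambda>z. (SUP y\<in>{1..} \<inter> \<rat>. g y) < g z) (at_right y)"
        by (intro order_tendstoD(1)[OF cont[OF y]]) simp
      then obtain b where b: "y < b" "\<And>z. y < z \<Longrightarrow> z < b \<Longrightarrow> (SUP y\<in>{1..} \<inter> \<rat>. g y) < g z"
        by (auto simp: eventually_at_right_field)
      obtain z where z: "z \<in> \<rat>" "y < z" "z < b" using Rats_dense_in_real[OF b(1)] by blast
      have "g z \<le> (SUP y\<in>{1..} \<inter> \<rat>. g y)"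
        using z y by (intro cSUP_upper bdd') auto
      then show False using b(2)[of z] z by simp
    qed
  qed auto
  show "(SUP y\<in>{1..} \<inter> \<rat>. g y) \<le> (SUP y\<in>{1..}. g y)"
    by (rule cSUP_subset_mono) (auto intro: bdd exI[of _ 1])
qed

lemma indicator_right_continuous:
  fixes r y :: real
  shows "((\<lambda>z. indicator {z<..} r) \<longlongrightarrow> (indicator {y<..} r :: real)) (at_right y)"
proof (rule tendsto_eventually, cases "y < r")
  case True
  then show "eventually (\<lambda>z. indicator {z<..} r = (indicator {y<..} r :: real)) (at_right y)"
    using eventually_at_right_real[OF True] by (auto elim!: eventually_mono simp: indicator_def)
next
  case False
  then show "eventually (\<lambda>z. indicator {z<..} r = (indicator {y<..} r :: real)) (at_right y)"
    using eventually_at_right_less[of y] by (auto elim!: eventually_mono simp: indicator_def)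
qed

lemma KS_dist_measurable:
  assumes X: "\<And>i. i \<in> {1..n} \<Longrightarrow> X i \<in> borel_measurable M" and k: "k \<in> {1..n-1}"
  shows "(\<lambda>\<omega>. KS_dist (\<lambda>i. X i \<omega>) n k) \<in> borel_measurable M"
proof -
  define a where "a \<omega> = alpha_hat (\<lambda>i. X i \<omega>) n k" for \<omega>
  define R where "R i \<omega> = order_stat (\<lambda>i. X i \<omega>) n (n - k + i) / order_stat (\<lambda>i. X i \<omega>) n (n - k)" for i \<omega>
  define p where "p y \<omega> = 1 / real k * (\<Sum>i=1..k. indicator {y<..} (R i \<omega>))" for y \<omega>
  have [measurable]: "(\<lambda>\<omega>. order_stat (\<lambda>i. X i \<omega>) n j) \<in> borel_measurable M" if "1 \<le> j" "j \<le> n" for j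
    using assms that by (intro order_stat_measurable) auto
  have [measurable]: "R i \<in> borel_measurable M" if "i \<in> {1..k}" for i
  proof -
    have "1 \<le> n - k + i" "n - k + i \<le> n" "1 \<le> n - k" "n - k \<le> n" using that k by auto
    then show ?thesis unfolding R_def by measurable
  qed
  have [measurable]: "a \<in> borel_measurable M"
    unfolding a_def using assms by (rule alpha_hat_measurable)
  have [measurable]: "p y \<in> borel_measurable M" for y
    unfolding p_def by measurable
  have eq: "KS_dist (\<lambda>i. X i \<omega>) n k =
     (if 0 \<le> a \<omega> then SUP y\<in>{1..} \<inter> \<rat>. \<bar>p y \<omega> - y powr - max 0 (a \<omega>)\<bar> else Sup UNIV)" for \<omega>
  proof (cases "0 \<le> a \<omega>")
    case True
    have "(SUP y\<in>{1..}. \<bar>p y \<omega> - y powr - a \<omega>\<bar>) = (SUP y\<in>{1..} \<inter> \<rat>. \<bar>p y \<omega> - y powr - a \<omega>\<bar>)"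
    proof (rule SUP_rat_right_continuous)
      show "bdd_above ((\<lambda>y. \<bar>p y \<omega> - y powr - a \<omega>\<bar>) ` {1..})"
        unfolding p_def using True by (intro bdd_above_tail_diff KS_frac_bounds) auto
      show "((\<lambda>y. \<bar>p y \<omega> - y powr - a \<omega>\<bar>) \<longlongrightarrow> \<bar>p y \<omega> - y powr - a \<omega>\<bar>) (at_right y)" if "1 \<le> y" for y
        unfolding p_def using that by (intro tendsto_intros indicator_right_continuous) auto
    qed
    then show ?thesis using True by (simp add: KS_dist_def p_def R_def a_def)
  next
    case False
    have "\<not> bdd_above ((\<lambda>y. \<bar>p y \<omega> - y powr - a \<omega>\<bar>) ` {1..})"
    proof
      assume "bdd_above ((\<lambda>y. \<bar>p y \<omega> - y powr - a \<omega>\<bar>) ` {1..})"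
      then obtain B where B: "\<And>y. 1 \<le> y \<Longrightarrow> \<bar>p y \<omega> - y powr - a \<omega>\<bar> \<le> B"
        by (auto simp: bdd_above_def)
      \<comment> \<open>The point where the power function takes the value \<open>\<bar>B\<bar> + 2\<close>.\<close>
      define z where "z = (\<bar>B\<bar> + 2) powr (- 1 / a \<omega>)"
      have "0 \<le> - 1 / a \<omega>" using False by (simp add: divide_nonpos_neg)
      then have z: "1 \<le> z" unfolding z_def by (intro ge_one_powr_ge_zero) auto
      have "z powr - a \<omega> = \<bar>B\<bar> + 2" using False by (simp add: z_def powr_powr)
      then show False
        using B[OF z] KS_frac_bounds(2)[of k z "\<lambda>i. R i \<omega>"] unfolding p_def by linarith
    qed
    moreover have "\<not> bdd_above (UNIV :: real set)"
      unfolding bdd_above_def by (meson UNIV_I gt_ex not_le)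
    ultimately have "KS_dist (\<lambda>i. X i \<omega>) n k = Sup UNIV"
      unfolding KS_dist_def by (intro Sup_not_bdd_above) (auto simp: p_def R_def a_def)
    then show ?thesis using False by simp
  qed
  have bdd: "bdd_above ((\<lambda>y. \<bar>p y \<omega> - y powr - max 0 (a \<omega>)\<bar>) ` ({1..} \<inter> \<rat>))" for \<omega>
    unfolding p_def by (intro bdd_above_tail_diff KS_frac_bounds) auto
  have [measurable]: "(\<lambda>\<omega>. SUP y\<in>{1..} \<inter> \<rat>. \<bar>p y \<omega> - y powr - max 0 (a \<omega>)\<bar>) \<in> borel_measurable M"
    by (intro borel_measurable_cSUP bdd) (measurable, auto intro: countable_rat countable_subset)
  show ?thesis unfolding eq by measurable
qed

lemma PLFit_measurable:
  assumes X: "\<And>i. i \<in> {1..n} \<Longrightarrow> X i \<in> borel_measurable M" and n: "2 \<le> n"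
  shows "(\<lambda>\<omega>. PLFit (\<lambda>i. X i \<omega>) n) \<in> borel_measurable M"
proof -
  \<comment> \<open>Outside \<open>{1..n-1}\<close> the statistics are replaced by \<open>0\<close>, so that they are measurable for every \<open>k\<close> and a random index may be substituted.\<close>
  define D where "D k \<omega> = (if k \<in> {1..n-1} then KS_dist (\<lambda>i. X i \<omega>) n k else 0)" for k \<omega>
  define A where "A k \<omega> = (if k \<in> {1..n-1} then alpha_hat (\<lambda>i. X i \<omega>) n k else 0)" for k \<omega>
  define \<kappa> where "\<kappa> \<omega> = kappa_star (\<lambda>i. X i \<omega>) n" for \<omega>
  have [measurable]: "D k \<in> borel_measurable M" for k
    unfolding D_def using KS_dist_measurable[OF X] by (cases "k \<in> {1..n-1}") (simp_all only: if_True if_False, auto)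
  have [measurable]: "A k \<in> borel_measurable M" for k
    unfolding A_def using alpha_hat_measurable[OF X] by (cases "k \<in> {1..n-1}") (simp_all only: if_True if_False, auto)
  have "\<kappa> \<omega> = (LEAST k. k \<in> {1..n-1} \<and> (\<forall>l\<in>{1..n-1}. D k \<omega> \<le> D l \<omega>))" for \<omega>
    unfolding \<kappa>_def kappa_star_def by (rule arg_cong[where f = Least]) (auto simp: is_arg_min_def D_def fun_eq_iff not_less)
  then have \<kappa>: "\<kappa> = (\<lambda>\<omega>. LEAST k. k \<in> {1..n-1} \<and> (\<forall>l\<in>{1..n-1}. D k \<omega> \<le> D l \<omega>))"
    by (rule ext)
  have [measurable]: "\<kappa> \<in> measurable M (count_space UNIV)"
    unfolding \<kappa> by measurable
  have "(\<lambda>\<omega>. A (\<kappa> \<omega>) \<omega>) \<in> borel_measurable M"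
    by (rule measurable_compose_countable) auto
  moreover have "A (\<kappa> \<omega>) \<omega> = PLFit (\<lambda>i. X i \<omega>) n" for \<omega>
    using kappa_star_props(1)[OF n] by (simp add: A_def \<kappa>_def PLFit_def)
  ultimately show ?thesis by simp
qed

section \<open>Regularly varying tails\<close>

locale rv_tail =
  fixes G :: "real \<Rightarrow> real" and \<alpha> :: real
  assumes alpha_pos: "0 < \<alpha>"
    and G_antimono: "\<And>s t. s \<le> t \<Longrightarrow> G t \<le> G s"
    and G_cont: "continuous_on UNIV G"
    and G_1: "\<And>t. t \<le> 1 \<Longrightarrow> G t = 1"
    and G_lim: "(G \<longlongrightarrow> 0) at_top"
    and G_rv: "regularly_varying (- \<alpha>) G"
begin

lemma G_ratio_tendsto: "0 < y \<Longrightarrow> ((\<lambda>t. G (y * t) / G t) \<longlongrightarrow> y powr - \<alpha>) at_top"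
  using G_rv by (auto simp: regularly_varying_def mult.commute[of y])

lemma G_nonneg: "0 \<le> G t"
proof (rule tendsto_upperbound[OF G_lim])
  show "eventually (\<lambda>s. G s \<le> G t) at_top"
    using eventually_ge_at_top[of t] by eventually_elim (rule G_antimono)
qed simp

text \<open>
  If \<open>G\<close> vanished somewhere, it would vanish from there on, and \<open>G t / G t\<close> would be \<open>0 / 0 = 0\<close>,
  contradicting regular variation at the factor \<open>1\<close>.
\<close>

lemma G_pos: "0 < G t"
proof (rule ccontr)
  assume "\<not> 0 < G t"
  then have "G t \<le> 0" by simp
  have "eventually (\<lambda>s. G (1 * s) / G s = 0) at_top"
    using eventually_ge_at_top[of t]
  proof eventually_elim
    case (elim s)
    then show ?case using G_antimono[of t s] G_nonneg[of s] \<open>G t \<le> 0\<close> by simp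
  qed
  then have "((\<lambda>s. G (1 * s) / G s) \<longlongrightarrow> 0) at_top" by (rule tendsto_eventually)
  with G_ratio_tendsto[of 1] show False by (auto dest: tendsto_unique[rotated])
qed

lemma G_le_1: "G t \<le> 1"
  using G_antimono[of "min t 1" t] G_1[of "min t 1"] by simp

lemma G_attains:
  assumes "0 < p" "p \<le> 1"
  shows "\<exists>t. G t = p"
proof -
  have "eventually (\<lambda>t. G t < p) at_top" using G_lim assms(1) by (rule order_tendstoD)
  then obtain b0 where "\<And>t. b0 \<le> t \<Longrightarrow> G t < p" by (auto simp: eventually_at_top_linorder)
  then have b: "1 \<le> max 1 b0" "G (max 1 b0) < p" by auto
  have "\<exists>t\<ge>1. t \<le> max 1 b0 \<and> G t = p"
    using assms b G_1[of 1] continuous_on_subset[OF G_cont]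
    by (intro IVT2') auto
  then show ?thesis by blast
qed

lemma G_ratio_nonneg: "0 \<le> G (y * u) / G u"
  using G_pos[of u] G_pos[of "y * u"] by simp

text \<open>
  Convergence of monotone functions to a continuous limit is uniform (Polya): the levels \<open>1 - j / m\<close> of
  the limit are attained at finitely many points \<open>Y j\<close>, convergence at these points is uniform, and
  between two neighbouring points both functions change by at most \<open>1 / m\<close> up to the error at the points.
\<close>

lemma ratio_uniform:
  assumes "0 < \<epsilon>"
  shows "\<exists>t0\<ge>1. \<forall>u\<ge>t0. \<forall>y\<ge>1. \<bar>G (y * u) / G u - y powr - \<alpha>\<bar> \<le> \<epsilon>"
proof -
  obtain m :: nat where m': "2 / \<epsilon> < real m" using reals_Archimedean2 by blast
  moreover have "0 < 2 / \<epsilon>" using assms by simp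
  ultimately have "0 < real m" by linarith
  then have m: "0 < m" "2 / real m < \<epsilon>" using m' assms by (auto simp: field_simps)
  define Y where "Y j = (1 - real j / real m) powr (- 1 / \<alpha>)" for j :: nat
  have Ypos: "0 < Y j" if "j < m" for j using that m by (simp add: Y_def)
  have Yp: "Y j powr - \<alpha> = 1 - real j / real m" if "j < m" for j
    using that m alpha_pos by (simp add: Y_def powr_powr)
  have "eventually (\<lambda>u. \<forall>j\<in>{..<m}. dist (G (Y j * u) / G u) (Y j powr - \<alpha>) < 1 / m) at_top"
    using m Ypos by (intro eventually_ball_finite ballI tendstoD G_ratio_tendsto) auto
  then obtain t0 where t0: "\<And>u j. t0 \<le> u \<Longrightarrow> j < m \<Longrightarrow> \<bar>G (Y j * u) / G u - Y j powr - \<alpha>\<bar> < 1 / m"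
    by (auto simp: eventually_at_top_linorder dist_real_def)
  have "\<bar>G (y * u) / G u - y powr - \<alpha>\<bar> \<le> \<epsilon>" if u: "max 1 t0 \<le> u" and y: "1 \<le> y" for u y
  proof -
    define w where "w = y powr - \<alpha>"
    have w: "0 < w" "w \<le> 1" using y alpha_pos powr_mono[of "-\<alpha>" 0 y] by (auto simp: w_def)
    have yw: "y = w powr (- 1 / \<alpha>)" using y alpha_pos by (simp add: w_def powr_powr)
    define j where "j = nat \<lfloor>real m * (1 - w)\<rfloor>"
    have "0 \<le> real m * (1 - w)" using w by simp
    then have j: "real j \<le> real m * (1 - w)" "real m * (1 - w) < real j + 1"
      unfolding j_def by linarith+
    have "real m * (1 - w) < m" using w m by simp
    then have jm: "j < m" using j by linarith
    have mw: "real j / m \<le> 1 - w" "1 - w < (real j + 1) / m"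
      using j m by (auto simp: field_simps)
    have Yj: "Y j \<le> y"
      unfolding Y_def yw using mw jm m w alpha_pos by (intro powr_mono2') auto
    have up: "G (y * u) / G u \<le> w + 2 / m"
    proof -
      have "G (y * u) / G u \<le> G (Y j * u) / G u"
        using Yj u G_pos[of u] by (intro divide_right_mono G_antimono mult_right_mono) auto
      also have "\<dots> \<le> (1 - real j / m) + 1 / m" using t0[of u j] u jm Yp[of j] by auto
      also have "\<dots> \<le> w + 2 / m" using mw by (simp add: add_divide_distrib)
      finally show ?thesis .
    qed
    have lo: "w - 2 / m \<le> G (y * u) / G u"
    proof (cases "Suc j < m")
      case True
      have "w - 2 / m \<le> 1 - (real j + 1) / m - 1 / m" using mw by (simp add: add_divide_distrib)
      also have "\<dots> \<le> G (Y (Suc j) * u) / G u" using t0[of u "Suc j"] u True Yp[of "Suc j"] by (auto simp: add.commute)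
      also have "\<dots> \<le> G (y * u) / G u"
      proof (intro divide_right_mono G_antimono mult_right_mono)
        show "y \<le> Y (Suc j)"
          unfolding Y_def yw using mw True m w alpha_pos
          by (intro powr_mono2') (auto simp: add.commute)
      qed (use u G_pos[of u] in auto)
      finally show ?thesis .
    next
      case False
      then have "real j + 1 = m" using jm by linarith
      then have "w \<le> 1 / m" using mw m by (simp add: field_simps)
      moreover have "1 / real m \<le> 2 / real m" by (simp add: divide_right_mono)
      ultimately show ?thesis using G_ratio_nonneg[of y u] by linarith
    qed
    show ?thesis using up lo m unfolding w_def by linarith
  qed
  then show ?thesis by (intro exI[of _ "max 1 t0"]) auto
qed

text \<open>
  A crude substitute for the Potter bounds, uniform in the number \<open>j\<close> of doublings: beyond some point \<open>G\<close>
  decreases with each doubling by a factor close to \<open>2 powr - \<alpha>\<close>, so certainly by \<open>2 powr (- \<alpha> / 2)\<close>.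
\<close>

lemma doubling:
  "\<exists>t0\<ge>1. \<forall>t\<ge>t0. \<forall>j::nat. G (2 ^ j * t) \<le> (2 powr (- \<alpha> / 2)) ^ j * G t"
proof -
  have "eventually (\<lambda>t. G (2 * t) / G t < 2 powr (- \<alpha> / 2)) at_top"
    using alpha_pos by (intro order_tendstoD(2)[OF G_ratio_tendsto]) auto
  then obtain t1 where t1: "\<And>t. t1 \<le> t \<Longrightarrow> G (2 * t) / G t < 2 powr (- \<alpha> / 2)"
    by (auto simp: eventually_at_top_linorder)
  have "G (2 ^ j * t) \<le> (2 powr (- \<alpha> / 2)) ^ j * G t" if t: "max 1 t1 \<le> t" for t and j :: nat
  proof (induction j)
    case (Suc j)
    have "t \<le> 2 ^ j * t" using t by simp
    then have "t1 \<le> 2 ^ j * t" using t by linarith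
    then have "G (2 * (2 ^ j * t)) \<le> 2 powr (- \<alpha> / 2) * G (2 ^ j * t)"
      using t1[of "2 ^ j * t"] G_pos[of "2 ^ j * t"] by (simp add: field_simps)
    also have "\<dots> \<le> 2 powr (- \<alpha> / 2) * ((2 powr (- \<alpha> / 2)) ^ j * G t)"
      using Suc by (intro mult_left_mono) auto
    finally show ?case by (simp add: mult.assoc)
  qed simp
  then show ?thesis by (intro exI[of _ "max 1 t1"]) auto
qed

lemma exact_pareto_index:
  assumes "0 < u" and eq: "\<And>y. 1 \<le> y \<Longrightarrow> G (y * u) / G u = y powr - b"
  shows "b = \<alpha>"
proof -
  have "eventually (\<lambda>t. G (2 * t) / G t = 2 powr - b) at_top"
    using eventually_ge_at_top[of u]
  proof eventually_elim
    case (elim t)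
    define y where "y = t / u"
    have y: "1 \<le> y" "t = y * u" using elim assms(1) by (auto simp: y_def)
    have 1: "G (y * u) = y powr - b * G u" using eq[of y] y(1) G_pos[of u] by (simp add: field_simps)
    have 2: "G ((2 * y) * u) = (2 * y) powr - b * G u" using eq[of "2 * y"] y(1) G_pos[of u] by (simp add: field_simps)
    have "G (2 * t) / G t = ((2 * y) powr - b * G u) / (y powr - b * G u)"
      unfolding y(2) by (simp only: mult.assoc[symmetric] 2) (simp only: 1)
    then show ?case using y(1) G_pos[of u] by (simp add: powr_mult)
  qed
  then have "((\<lambda>t. G (2 * t) / G t) \<longlongrightarrow> 2 powr - b) at_top" by (rule tendsto_eventually)
  then have "2 powr - b = (2::real) powr - \<alpha>"
    using G_ratio_tendsto[of 2] by (auto dest: tendsto_unique[rotated])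
  then show ?thesis by (simp add: powr_inj)
qed

lemma exponent_tendsto:
  fixes a :: "nat \<Rightarrow> real"
  assumes "(\<lambda>n. 2 powr - a n) \<longlonglongrightarrow> 2 powr - b"
  shows "a \<longlonglongrightarrow> b"
proof -
  have log: "- log 2 (2 powr - c) = c" for c :: real by (subst log_powr_cancel) auto
  have "(\<lambda>n. - log 2 (2 powr - a n)) \<longlonglongrightarrow> - log 2 (2 powr - b)"
    by (intro tendsto_minus tendsto_log tendsto_const assms) auto
  then show ?thesis unfolding log .
qed

text \<open>
  The sequential form of the identification. If \<open>u\<close> tends to infinity, then \<open>2 powr - a n\<close> has the same limit
  as \<open>G (2 * u n) / G (u n)\<close>, namely \<open>2 powr - \<alpha>\<close>. Otherwise a subsequence of \<open>u\<close> converges to some \<open>l\<close>, by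
  continuity of \<open>G\<close> the tail is exactly a power beyond \<open>l\<close>, and \<open>exact_pareto_index\<close> applies.
\<close>

lemma pareto_fit_sequence:
  fixes u a d :: "nat \<Rightarrow> real"
  assumes u: "\<And>n. 1 \<le> u n" and d: "d \<longlonglongrightarrow> 0"
    and fit: "\<And>n y. 1 \<le> y \<Longrightarrow> \<bar>G (y * u n) / G (u n) - y powr - a n\<bar> \<le> d n"
  shows "\<exists>r. strict_mono r \<and> (a \<circ> r) \<longlonglongrightarrow> \<alpha>"
proof (cases "filterlim u at_top sequentially")
  case True
  have "(\<lambda>n. G (2 * u n) / G (u n) - (G (2 * u n) / G (u n) - 2 powr - a n)) \<longlonglongrightarrow> 2 powr - \<alpha> - 0"
  proof (rule tendsto_diff)
    show "(\<lambda>n. G (2 * u n) / G (u n)) \<longlonglongrightarrow> 2 powr - \<alpha>"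
      using filterlim_compose[OF G_ratio_tendsto[of 2] True] by simp
    show "(\<lambda>n. G (2 * u n) / G (u n) - 2 powr - a n) \<longlonglongrightarrow> 0"
      by (rule Lim_null_comparison[OF _ d]) (rule always_eventually, simp add: fit)
  qed
  then have "(\<lambda>n. 2 powr - a n) \<longlonglongrightarrow> 2 powr - \<alpha>" unfolding diff_diff_eq2 by simp
  then have "a \<longlonglongrightarrow> \<alpha>" by (rule exponent_tendsto)
  moreover have "strict_mono (\<lambda>n::nat. n)" by (simp add: strict_mono_def)
  ultimately show ?thesis by (intro exI[of _ "\<lambda>n. n"]) (simp add: comp_def)
next
  case False
  then obtain Z where "\<not> eventually (\<lambda>n. Z \<le> u n) sequentially"
    unfolding filterlim_at_top by blast
  then have "\<exists>\<^sub>F n in sequentially. u n \<le> Z"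
    unfolding not_eventually by (rule frequently_elim1) simp
  then have "infinite {n. u n \<le> Z}" by (simp add: frequently_cofinite cofinite_eq_sequentially[symmetric])
  from infinite_enumerate[OF this]
  obtain s :: "nat \<Rightarrow> nat" where s: "strict_mono s" "\<And>n. u (s n) \<le> Z"
    by blast
  have "seq_compact {1..Z}" by (intro compact_imp_seq_compact compact_Icc)
  moreover have "\<forall>n. u (s n) \<in> {1..Z}" using s u by auto
  ultimately have "\<exists>l\<in>{1..Z}. \<exists>r. strict_mono r \<and> ((\<lambda>n. u (s n)) \<circ> r) \<longlonglongrightarrow> l"
    unfolding seq_compact_def by (elim allE[of _ "\<lambda>n. u (s n)"]) (erule mp)
  then obtain l r where l: "l \<in> {1..Z}" and r: "strict_mono r" "((\<lambda>n. u (s n)) \<circ> r) \<longlonglongrightarrow> l"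
    by blast
  define q where "q = s \<circ> r"
  have q: "strict_mono q" using s r by (simp add: q_def strict_mono_o)
  have uq: "(\<lambda>n. u (q n)) \<longlonglongrightarrow> l" using r by (simp add: q_def comp_def)
  have dq: "(\<lambda>n. d (q n)) \<longlonglongrightarrow> 0" using LIMSEQ_subseq_LIMSEQ[OF d q] by (simp add: comp_def)
  have Gt: "(\<lambda>n. G (z n)) \<longlonglongrightarrow> G w" if "z \<longlonglongrightarrow> w" for z w
    using continuous_on_tendsto_compose[OF G_cont that] by simp
  have lim: "(\<lambda>n. y powr - a (q n)) \<longlonglongrightarrow> G (y * l) / G l" if "1 \<le> y" for y
  proof -
    have "(\<lambda>n. G (y * u (q n)) / G (u (q n)) - (G (y * u (q n)) / G (u (q n)) - y powr - a (q n)))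
            \<longlonglongrightarrow> G (y * l) / G l - 0"
    proof (rule tendsto_diff)
      show "(\<lambda>n. G (y * u (q n)) / G (u (q n))) \<longlonglongrightarrow> G (y * l) / G l"
        using uq G_pos[of l] by (intro tendsto_divide Gt tendsto_mult tendsto_const) auto
      show "(\<lambda>n. G (y * u (q n)) / G (u (q n)) - y powr - a (q n)) \<longlonglongrightarrow> 0"
        by (rule Lim_null_comparison[OF _ dq]) (rule always_eventually, simp add: fit that)
    qed
    then show ?thesis by simp
  qed
  \<comment> \<open>The only possible limit of \<open>a \<circ> q\<close>, as the case \<open>y = 2\<close> of the previous limit shows.\<close>
  define b where "b = - log 2 (G (2 * l) / G l)"
  have two: "2 powr - b = G (2 * l) / G l" using G_pos[of l] G_pos[of "2 * l"] by (simp add: b_def)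
  have "(\<lambda>n. 2 powr - a (q n)) \<longlonglongrightarrow> 2 powr - b" unfolding two by (rule lim) simp
  then have ab: "(\<lambda>n. a (q n)) \<longlonglongrightarrow> b" by (rule exponent_tendsto)
  have "b = \<alpha>"
  proof (rule exact_pareto_index)
    show "0 < l" using l by simp
    fix y :: real assume y: "1 \<le> y"
    have "(\<lambda>n. y powr - a (q n)) \<longlonglongrightarrow> y powr - b"
      using y ab by (intro tendsto_intros) auto
    then show "G (y * l) / G l = y powr - b" by (rule LIMSEQ_unique[OF lim[OF y]])
  qed
  then have "(a \<circ> q) \<longlonglongrightarrow> \<alpha>" using ab by (simp add: comp_def)
  with q show ?thesis by blast
qed

text \<open>
  The bound is uniform in \<open>u\<close>, so that it can be applied at a random threshold about which nothing else
  is known.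
\<close>

lemma index_identified:
  assumes "0 < \<eta>"
  shows "\<exists>\<delta>>0. \<forall>u\<ge>1. \<forall>a. (\<forall>y\<ge>1. \<bar>G (y * u) / G u - y powr - a\<bar> \<le> \<delta>) \<longrightarrow> \<bar>a - \<alpha>\<bar> \<le> \<eta>"
proof (rule ccontr)
  assume "\<not> ?thesis"
  then have neg: "\<And>\<delta>. 0 < \<delta> \<Longrightarrow> \<exists>u a. 1 \<le> u \<and> (\<forall>y\<ge>1. \<bar>G (y * u) / G u - y powr - a\<bar> \<le> \<delta>) \<and> \<eta> < \<bar>a - \<alpha>\<bar>"
    by (simp only: not_ex not_all de_Morgan_conj not_imp not_le) blast
  have "\<forall>n::nat. \<exists>u a. 1 \<le> u \<and> (\<forall>y\<ge>1. \<bar>G (y * u) / G u - y powr - a\<bar> \<le> inverse (Suc n)) \<and> \<eta> < \<bar>a - \<alpha>\<bar>"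
    by (intro allI neg) simp
  from choice[OF this] obtain u where
    "\<forall>n::nat. \<exists>a. 1 \<le> u n \<and> (\<forall>y\<ge>1. \<bar>G (y * u n) / G (u n) - y powr - a\<bar> \<le> inverse (Suc n)) \<and> \<eta> < \<bar>a - \<alpha>\<bar>"
    by blast
  from choice[OF this] obtain a where ua: "\<And>n::nat. 1 \<le> u n"
    "\<And>n y. 1 \<le> y \<Longrightarrow> \<bar>G (y * u n) / G (u n) - y powr - a n\<bar> \<le> inverse (Suc n)"
    "\<And>n. \<eta> < \<bar>a n - \<alpha>\<bar>" by blast
  from pareto_fit_sequence[OF ua(1) LIMSEQ_inverse_real_of_nat ua(2)]
  obtain r where "(a \<circ> r) \<longlonglongrightarrow> \<alpha>" by blast
  from tendstoD[OF this assms] have "eventually (\<lambda>n. False) sequentially"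
  proof eventually_elim
    case (elim n)
    then show ?case using ua(3)[of "r n"] by (simp add: dist_real_def)
  qed
  then show False by simp
qed

end

section \<open>Samples whose empirical tail is close to the true tail\<close>

text \<open>
  Levels with fewer than \<open>K\<close> expected exceedances are left out, because there relative errors do not become
  small. The upper bound is for \<open>reach\<close> and the lower one for \<open>exceed\<close>, so that both bounds hold for both
  counts.
\<close>

definition uniformly_close ::
  "(real \<Rightarrow> real) \<Rightarrow> (nat \<Rightarrow> real) \<Rightarrow> nat \<Rightarrow> real \<Rightarrow> real \<Rightarrow> bool" where
  "uniformly_close G x n e K \<longleftrightarrow> (\<forall>t. K \<le> real n * G t \<longrightarrow>
     (1 - e) * (real n * G t) \<le> exceed x n t \<and> reach x n t \<le> (1 + e) * (real n * G t))"

context rv_tail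
begin

text \<open>
  Closeness at \<open>u\<close> and at \<open>y * u\<close> gives closeness of the quotients. If \<open>y * u\<close> lies in the region with fewer
  than \<open>K\<close> expected exceedances, where nothing is known, comparison with the boundary point \<open>v0\<close> of that
  region shows that both quotients are below \<open>e\<close>, because \<open>k\<close> is much larger than \<open>K\<close>.
\<close>

lemma uniformly_close_ratio:
  assumes close: "uniformly_close G x n e K" and e: "0 < e" "e \<le> 1 / 2" and K: "0 < K"
    and k: "1 \<le> k" "k \<le> n - 1" "2 * K / e \<le> real k"
    and u: "u = order_stat x n (n - k)" "0 < u" and y: "1 \<le> y"
  shows "\<bar>exceed x n (y * u) / real k - G (y * u) / G u\<bar> \<le> 4 * e"
proof -
  have "2 * K \<le> e * real k" using k(3) e by (simp add: field_simps)
  moreover have "e * real k \<le> 1 / 2 * real k" using e k by (intro mult_right_mono) auto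
  ultimately have Kk: "4 * K \<le> real k" by linarith
  have kn: "real k < real n" "0 < real n" using k by auto
  have "0 < K / real n" "K / real n \<le> 1" using K Kk kn by (auto simp: field_simps)
  then obtain v0 where "G v0 = K / real n" using G_attains by blast
  then have v0: "real n * G v0 = K" using kn by simp
  have reach_v0: "reach x n v0 \<le> (1 + e) * K"
    using close v0 unfolding uniformly_close_def by (metis order_refl)
  have eK: "(1 + e) * K \<le> 3 / 2 * K" using e K by (intro mult_right_mono) auto
  have below: "v0 < v" if "real n * G v < K" for v
  proof (rule ccontr)
    assume "\<not> v0 < v"
    then have "G v0 \<le> G v" by (intro G_antimono) simp
    then show False using that v0 kn mult_left_mono[of "G v0" "G v" "real n"] by simp
  qed
  have N_u: "exceed x n u \<le> k" "k \<le> reach x n u"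
    using exceed_order_stat_le[of k n x] le_reach_order_stat[of k n x] k u by auto
  have Ku: "K \<le> real n * G u"
  proof (rule ccontr)
    assume "\<not> K \<le> real n * G u"
    then have "v0 < u" by (intro below) simp
    then have "reach x n u \<le> reach x n v0" by (intro reach_antimono) simp
    then show False using N_u(2) reach_v0 eK Kk K by linarith
  qed
  define g where "g = real n * G u"
  define h where "h = real n * G (y * u)"
  have g: "0 < g" using Ku K by (simp add: g_def)
  have kg: "(1 - e) * g \<le> k" "k \<le> (1 + e) * g"
    using close Ku N_u unfolding uniformly_close_def g_def by (metis order_trans)+
  have h0: "0 < h" using G_pos[of "y * u"] kn by (simp add: h_def)
  have "u \<le> y * u" using y u by simp
  then have hg: "h \<le> g" unfolding h_def g_def by (intro mult_left_mono G_antimono) auto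
  have ratio: "G (y * u) / G u = h / g" using kn by (simp add: h_def g_def)
  have k0: "0 < real k" using k by simp
  show ?thesis
  proof (cases "K \<le> h")
    case True
    have N: "(1 - e) * h \<le> exceed x n (y * u)" "exceed x n (y * u) \<le> (1 + e) * h"
      using close True exceed_le_reach[of x n "y * u"]
      unfolding uniformly_close_def h_def by (metis order_trans)+
    have r: "0 \<le> h / g" "h / g \<le> 1" using h0 hg g by auto
    \<comment> \<open>The constant \<open>4\<close> comes from \<open>(1 + e) / (1 - e) \<le> 1 + 4 * e\<close>, valid for \<open>e \<le> 1 / 2\<close>.\<close>
    have "exceed x n (y * u) / k \<le> (1 + e) * h / ((1 - e) * g)"
      using N kg e g h0 by (intro frac_le) auto
    also have "\<dots> = (1 + e) / (1 - e) * (h / g)" by simp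
    also have "\<dots> \<le> (1 + 4 * e) * (h / g)"
    proof (intro mult_right_mono r)
      have "e * e \<le> e * (1 / 2)" using e by (intro mult_left_mono) auto
      then have "1 + e \<le> (1 + 4 * e) * (1 - e)" by (simp add: algebra_simps)
      then show "(1 + e) / (1 - e) \<le> 1 + 4 * e" using e by (simp add: divide_le_eq)
    qed
    finally have up: "exceed x n (y * u) / k \<le> (1 + 4 * e) * (h / g)" .
    have "(1 - 4 * e) * (h / g) \<le> (1 - e) / (1 + e) * (h / g)"
    proof (intro mult_right_mono r)
      have "(1 - 4 * e) * (1 + e) \<le> 1 - e" using e by (simp add: algebra_simps)
      then show "1 - 4 * e \<le> (1 - e) / (1 + e)" using e by (simp add: le_divide_eq)
    qed
    also have "\<dots> = (1 - e) * h / ((1 + e) * g)" by simp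
    also have "\<dots> \<le> exceed x n (y * u) / k"
      using N kg e g h0 k0 by (intro frac_le) (auto intro: order_trans[OF _ N(1)])
    finally have lo: "(1 - 4 * e) * (h / g) \<le> exceed x n (y * u) / k" .
    have combine: "\<bar>N - q\<bar> \<le> 4 * e"
      if "N \<le> (1 + 4 * e) * q" "(1 - 4 * e) * q \<le> N" "q \<le> 1" for N q
    proof -
      have "e * q \<le> e * 1" using e that by (intro mult_left_mono) auto
      then show ?thesis using that by (simp add: algebra_simps abs_le_iff)
    qed
    show ?thesis unfolding ratio by (rule combine[OF up lo r(2)])
  next
    case False
    then have "v0 < y * u" by (intro below) (simp add: h_def)
    then have "exceed x n (y * u) \<le> (1 + e) * K"
      using exceed_antimono[of v0 "y * u" x n] exceed_le_reach[of x n v0] reach_v0 by simp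
    then have "exceed x n (y * u) \<le> 2 * K" using eK K by linarith
    then have 1: "exceed x n (y * u) / k \<le> e"
      using \<open>2 * K \<le> e * real k\<close> k0 by (simp add: divide_le_eq)
    have "h \<le> K" using False by simp
    moreover have "e * k \<le> e * (3 / 2 * g)"
    proof (intro mult_left_mono)
      have "(1 + e) * g \<le> 3 / 2 * g" using e g by (intro mult_right_mono) auto
      then show "k \<le> 3 / 2 * g" using kg by linarith
    qed (use e in auto)
    moreover have "e * (3 / 2 * g) = 3 / 2 * (e * g)" "0 < e * g" using e g by auto
    ultimately have "h \<le> e * g" using \<open>2 * K \<le> e * real k\<close> by linarith
    then have 2: "h / g \<le> e" using g by (simp add: divide_le_eq)
    have "0 \<le> exceed x n (y * u) / k" "0 \<le> h / g" using exceed_nonneg h0 g by auto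
    then show ?thesis using 1 2 e unfolding ratio by linarith
  qed
qed

text \<open>
  Closeness on the grid of points \<open>T j\<close> with \<open>G (T j) = q ^ j\<close> extends to every \<open>t\<close> by monotonicity. If
  \<open>q ^ Suc j < G t \<le> q ^ j\<close>, then \<open>t\<close> is strictly to the left of \<open>T (Suc j)\<close>; for the upper bound
  it is compared with \<open>T (j - 1)\<close>, since \<open>t\<close> may lie to the left of \<open>T j\<close> if \<open>G t = q ^ j\<close>. For
  \<open>j = 0\<close> the trivial bound by the sample size takes the place of the latter. The factors that result,
  \<open>(1 - d) / (1 + d)\<close> and \<open>(1 + d) ^ 3\<close>, lie between \<open>1 - 7 * d\<close> and \<open>1 + 7 * d\<close> for \<open>d \<le> 1\<close>.
\<close>

lemma uniformly_close_from_grid: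
  fixes d q K :: real
  assumes d: "0 < d" "d \<le> 1" and q: "q = 1 / (1 + d)" and T: "\<And>j. G (T j) = q ^ j"
    and n: "0 < n"
    and grid: "\<And>j. q * K \<le> real n * q ^ j \<Longrightarrow> \<bar>exceed x n (T j) - real n * q ^ j\<bar> < d * (real n * q ^ j)"
  shows "uniformly_close G x n (7 * d) K"
  unfolding uniformly_close_def
proof (intro allI impI)
  fix t assume Kt: "K \<le> real n * G t"
  have q01: "0 < q" "q < 1" "q * (1 + d) = 1" using d by (auto simp: q)
  have n0: "0 < real n" using n by simp
  have order: "s < t" if "G t < G s" for s t using that G_antimono[of t s] by (meson not_le)
  define j where "j = (LEAST j. q ^ Suc j < G t)"
  obtain j0 where "q ^ j0 < G t" using real_arch_pow_inv[OF G_pos q01(2)] by blast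
  moreover have "q ^ Suc j0 \<le> q ^ j0" using q01 by (intro power_decreasing) auto
  ultimately have "q ^ Suc j0 < G t" by linarith
  then have jl: "q ^ Suc j < G t" unfolding j_def by (rule LeastI)
  have ju: "G t \<le> q ^ j"
  proof (cases j)
    case 0 then show ?thesis using G_le_1 by simp
  next
    case (Suc i)
    then have "\<not> q ^ Suc i < G t" using not_less_Least[of i "\<lambda>j. q ^ Suc j < G t"] unfolding j_def by simp
    then show ?thesis using Suc by simp
  qed
  define g where "g = real n * G t"
  have g: "0 < g" using n0 G_pos[of t] by (simp add: g_def)
  define w where "w = real n * q ^ Suc j"
  have w: "w \<le> g" "q * g \<le> w" "0 < w"
  proof -
    show "w \<le> g" unfolding w_def g_def using jl by (intro mult_left_mono) auto
    have "q * (real n * G t) \<le> q * (real n * q ^ j)"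
      using ju q01 by (intro mult_left_mono) auto
    also have "\<dots> = w" unfolding w_def by (simp only: power_Suc mult_ac)
    finally show "q * g \<le> w" by (simp only: g_def)
    show "0 < w" using n0 q01 by (simp add: w_def)
  qed
  have "q * K \<le> q * g" unfolding g_def using Kt q01 by (intro mult_left_mono) auto
  then have qKw: "q * K \<le> w" using w by linarith
  have "t < T (Suc j)" by (rule order) (simp only: T jl)
  then have "exceed x n (T (Suc j)) \<le> exceed x n t" by (intro exceed_antimono) simp
  moreover have "w - d * w \<le> exceed x n (T (Suc j))"
  proof -
    have "\<bar>exceed x n (T (Suc j)) - w\<bar> < d * w"
      using grid[of "Suc j"] qKw unfolding w_def by blast
    then show ?thesis by linarith
  qed
  moreover have "(1 - 7 * d) * g \<le> w - d * w"
  proof -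
    have "(1 - 7 * d) * (1 + d) \<le> 1 - d" using d by (simp add: algebra_simps)
    then have "(1 - 7 * d) * (1 + d) * q \<le> (1 - d) * q" using q01 by (intro mult_right_mono) auto
    also have "(1 - 7 * d) * (1 + d) * q = (1 - 7 * d) * (q * (1 + d))" by (simp only: mult_ac)
    finally have "(1 - 7 * d) \<le> (1 - d) * q" by (simp only: q01(3) mult_1_right)
    then have "(1 - 7 * d) * g \<le> (1 - d) * q * g" using g by (intro mult_right_mono) auto
    also have "\<dots> = (1 - d) * (q * g)" by simp
    also have "\<dots> \<le> (1 - d) * w" using w d by (intro mult_left_mono) auto
    finally show ?thesis by (simp add: algebra_simps)
  qed
  moreover have "reach x n t \<le> (1 + 7 * d) * g"
  proof (cases j)
    case 0
    have "(1 + d) * w = n * (q * (1 + d))"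
      unfolding w_def 0 by (simp only: power_Suc power_0 mult_1_right mult_ac)
    then have "(1 + d) * w = n" by (simp only: q01(3) mult_1_right)
    moreover have "(1 + d) * w \<le> (1 + 7 * d) * g" using w d by (intro mult_mono) auto
    ultimately show ?thesis using reach_le[of x n t] by simp
  next
    case (Suc i)
    have "q ^ j < q ^ i" using Suc q01 by simp
    then have "T i < t" by (intro order[of t "T i"]) (use ju in \<open>simp add: T\<close>)
    then have "reach x n t \<le> exceed x n (T i)" by (rule reach_le_exceed)
    also have "\<dots> \<le> (1 + d) * (real n * q ^ i)"
    proof -
      have "w \<le> real n * q ^ i" using Suc q01 n0 unfolding w_def
        by (intro mult_left_mono power_decreasing) auto
      then have "q * K \<le> real n * q ^ i" using qKw by linarith
      from grid[OF this] show ?thesis by (simp add: algebra_simps abs_less_iff)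
    qed
    also have "real n * q ^ i = (1 + d)\<^sup>2 * w"
    proof -
      have "(1 + d)\<^sup>2 * w = real n * q ^ i * (q * (1 + d))\<^sup>2"
        unfolding w_def Suc by (simp only: power_Suc power2_eq_square mult_ac)
      then show ?thesis by (simp only: q01(3) power_one mult_1_right)
    qed
    also have "(1 + d) * ((1 + d)\<^sup>2 * w) \<le> (1 + 7 * d) * g"
    proof -
      have d2: "d * d \<le> d * 1" using d by (intro mult_left_mono) auto
      have "d * (d * d) \<le> d * 1" using d by (intro mult_left_mono mult_le_one) auto
      then have "(1 + d) * (1 + d)\<^sup>2 \<le> 1 + 7 * d" using d2 by (simp add: power2_eq_square algebra_simps)
      then have "(1 + d) * (1 + d)\<^sup>2 * w \<le> (1 + 7 * d) * g" using w d by (intro mult_mono) auto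
      then show ?thesis by (simp add: mult.assoc)
    qed
    finally show ?thesis .
  qed
  ultimately show "(1 - 7 * d) * (real n * G t) \<le> exceed x n t \<and> reach x n t \<le> (1 + 7 * d) * (real n * G t)"
    by (simp add: g_def)
qed

end

section \<open>The Hill statistic of a nearly Pareto sample\<close>

text \<open>
  With \<open>y = exp s\<close> the difference is at most \<open>(b - a) * s * exp (- a * s)\<close>, and \<open>a * s * exp (- a * s) \<le> 1\<close>.
  This makes it uniform in \<open>y\<close>.
\<close>

lemma powr_exponent_diff:
  fixes a b y :: real
  assumes "0 < a" "a \<le> b" "1 \<le> y"
  shows "\<bar>y powr - a - y powr - b\<bar> \<le> (b - a) / a"
proof -
  define s where "s = ln y"
  have s: "0 \<le> s" using assms by (simp add: s_def)
  have p: "y powr - c = exp (- c * s)" for c using assms by (simp add: powr_def s_def)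
  have le: "exp (- b * s) \<le> exp (- a * s)" using assms s by (simp add: mult_right_mono)
  have "exp (- a * s) - exp (- b * s) = exp (- a * s) * (1 - exp (- ((b - a) * s)))"
    by (simp add: algebra_simps flip: exp_add)
  also have "\<dots> \<le> exp (- a * s) * ((b - a) * s)"
    using exp_ge_add_one_self[of "- ((b - a) * s)"] by (intro mult_left_mono) auto
  also have "\<dots> = (b - a) / a * (a * s * exp (- (a * s)))"
    using assms by (simp add: field_simps)
  also have "\<dots> \<le> (b - a) / a * 1"
  proof (intro mult_left_mono)
    have "a * s \<le> exp (a * s)" using exp_ge_add_one_self[of "a * s"] by linarith
    then show "a * s * exp (- (a * s)) \<le> 1" by (simp add: exp_minus field_simps)
  qed (use assms in auto)
  finally show ?thesis using le by (simp add: p)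
qed

text \<open>
  The condition on \<open>\<rho>\<close> keeps \<open>H\<close> away from \<open>0\<close>, where inversion is not Lipschitz continuous; the rest is
  \<open>powr_exponent_diff\<close> with the smaller of the two exponents in the denominator.
\<close>

lemma powr_inverse_diff:
  fixes \<alpha> H y :: real
  assumes "0 < \<alpha>" "\<bar>H - 1 / \<alpha>\<bar> \<le> \<rho>" "\<rho> \<le> 1 / (2 * \<alpha>)" "1 \<le> y"
  shows "\<bar>y powr - inverse H - y powr - \<alpha>\<bar> \<le> 4 * \<rho> * \<alpha>"
proof -
  have H: "1 / (2 * \<alpha>) \<le> H" "0 < H"
  proof -
    have "1 / (2 * \<alpha>) = 1 / \<alpha> - 1 / (2 * \<alpha>)" using assms(1) by (simp add: field_simps)
    then show "1 / (2 * \<alpha>) \<le> H" using assms by linarith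
    moreover have "0 < 1 / (2 * \<alpha>)" using assms by simp
    ultimately show "0 < H" by linarith
  qed
  have 1: "1 / H \<le> 2 * \<alpha>" using H assms(1) by (simp add: field_simps)
  have \<rho>: "0 \<le> \<rho>" using assms(2) by linarith
  have dist: "\<bar>H * \<alpha> - 1\<bar> \<le> \<rho> * \<alpha>"
  proof -
    have "H * \<alpha> - 1 = (H - 1 / \<alpha>) * \<alpha>" using assms(1) by (simp add: field_simps)
    then have "\<bar>H * \<alpha> - 1\<bar> = \<bar>H - 1 / \<alpha>\<bar> * \<alpha>" using assms(1) by (simp add: abs_mult)
    then show ?thesis using assms by (simp add: mult_right_mono)
  qed
  show ?thesis
  proof (cases "inverse H \<le> \<alpha>")
    case True
    have "\<bar>y powr - inverse H - y powr - \<alpha>\<bar> \<le> (\<alpha> - inverse H) / inverse H"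
      using H True assms by (intro powr_exponent_diff) auto
    also have "\<dots> = H * \<alpha> - 1" using H by (simp add: field_simps)
    also have "\<dots> \<le> \<rho> * \<alpha>" using dist by linarith
    also have "\<dots> \<le> 4 * \<rho> * \<alpha>" using \<rho> assms by simp
    finally show ?thesis .
  next
    case False
    have "\<bar>y powr - inverse H - y powr - \<alpha>\<bar> = \<bar>y powr - \<alpha> - y powr - inverse H\<bar>" by simp
    also have "\<dots> \<le> (inverse H - \<alpha>) / \<alpha>"
      using H False assms by (intro powr_exponent_diff) auto
    also have "\<dots> = (1 - H * \<alpha>) * ((1 / H) / \<alpha>)" using H assms by (simp add: field_simps)
    also have "\<dots> \<le> (\<rho> * \<alpha>) * (2 * \<alpha> / \<alpha>)"
      using dist 1 H assms \<rho> by (intro mult_mono divide_right_mono) auto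
    also have "\<dots> \<le> 4 * \<rho> * \<alpha>" using \<rho> assms by simp
    finally show ?thesis .
  qed
qed

lemma has_integral_indicator_truncation:
  fixes z L :: real
  assumes "0 \<le> L"
  shows "((\<lambda>s. indicator {s<..} z) has_integral min (max 0 z) L) {0..L}"
proof -
  define c where "c = min (max 0 z) L"
  have c: "0 \<le> c" "c \<le> L" using assms by (auto simp: c_def)
  have "((\<lambda>s. indicator {s<..} z) has_integral c) {0..c}"
  proof (rule has_integral_spike_finite)
    show "((\<lambda>s. 1) has_integral c) {0..c}" using has_integral_const_real[of "1::real" 0 c] c by simp
    show "indicator {s<..} z = (1::real)" if "s \<in> {0..c} - {c}" for s
      using that by (auto simp: c_def indicator_def)
  qed simp
  moreover have "((\<lambda>s. indicator {s<..} z) has_integral (0::real)) {c..L}"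
  proof (rule has_integral_spike_finite)
    show "((\<lambda>s. 0) has_integral (0::real)) {c..L}" by simp
    show "indicator {s<..} z = (0::real)" if "s \<in> {c..L} - {L}" for s
      using that by (auto simp: c_def indicator_def)
  qed simp
  ultimately have "((\<lambda>s. indicator {s<..} z) has_integral (c + 0)) {0..L}"
    by (rule has_integral_combine[OF c])
  then show ?thesis by (simp add: c_def)
qed

text \<open>
  With \<open>z i = ln (x i / u)\<close>, the Hill statistic is the sum of the positive parts of the \<open>z i\<close>, divided by \<open>k\<close>.
  If they are cut off at \<open>L\<close>, it becomes the integral over \<open>s \<in> {0..L}\<close> of the empirical tail at \<open>exp s * u\<close>,
  which is compared with the integral \<open>(1 - exp (- \<alpha> * L)) / \<alpha>\<close> of \<open>exp (- \<alpha> * s)\<close>. The excesses over \<open>L\<close>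
  are bounded by \<open>e2\<close>.
  Truncation is essential, since a uniform error \<open>e1\<close> cannot be integrated over an infinite range.
\<close>

lemma hill_H_near:
  fixes \<alpha> L e1 e2 :: real
  assumes "0 < \<alpha>" "0 \<le> L" and k: "1 \<le> k" "k \<le> n - 1"
    and pos: "\<And>i. i \<in> {1..n} \<Longrightarrow> 0 < x i" and u: "u = order_stat x n (n - k)" "0 < u"
    and tail: "\<And>y. 1 \<le> y \<Longrightarrow> \<bar>exceed x n (y * u) / real k - y powr - \<alpha>\<bar> \<le> e1" 
    and rest: "(\<Sum>i=1..n. ln (max 1 (x i / (u * exp L)))) \<le> e2 * real k"
  shows "\<bar>hill_H x n k - 1 / \<alpha>\<bar> \<le> exp (- \<alpha> * L) / \<alpha> + e1 * L + e2"
proof -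
  define z where "z i = ln (x i / u)" for i
  define I where "I = (\<Sum>i=1..n. min (max 0 (z i)) L) / real k"
  define R where "R = (\<Sum>i=1..n. max 0 (z i - L)) / real k"
  have k0: "0 < real k" using k by simp
  have "hill_H x n k = (\<Sum>i=1..n. max 0 (z i)) / real k"
    using hill_H_eq[OF k _ pos] u by (simp add: z_def)
  also have "(\<Sum>i=1..n. max 0 (z i)) = (\<Sum>i=1..n. min (max 0 (z i)) L + max 0 (z i - L))"
    using assms(2) by (intro sum.cong) auto
  finally have H: "hill_H x n k = I + R"
    by (simp add: I_def R_def sum.distrib add_divide_distrib)
  have R: "0 \<le> R" "R \<le> e2"
  proof -
    show "0 \<le> R" unfolding R_def by (intro divide_nonneg_nonneg sum_nonneg) auto
    have "(\<Sum>i=1..n. max 0 (z i - L)) = (\<Sum>i=1..n. ln (max 1 (x i / (u * exp L))))"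
    proof (intro sum.cong refl)
      fix i assume "i \<in> {1..n}"
      then have xi: "0 < x i" by (rule pos)
      then have "z i - L = ln (x i / (u * exp L))"
        using u by (simp add: z_def ln_div ln_mult)
      moreover have "0 < x i / (u * exp L)" using xi u by simp
      ultimately show "max 0 (z i - L) = ln (max 1 (x i / (u * exp L)))"
        by (auto simp: max_def)
    qed
    then show "R \<le> e2" using rest k0 by (simp add: R_def divide_le_eq)
  qed
  have p: "exceed x n (exp s * u) = (\<Sum>i=1..n. indicator {s<..} (z i))" for s
    unfolding exceed_def
  proof (intro sum.cong refl)
    fix i assume "i \<in> {1..n}"
    then have xi: "0 < x i / u" using pos u by simp
    have "s < z i \<longleftrightarrow> exp s < x i / u" unfolding z_def using xi by (metis exp_less_cancel_iff exp_ln)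
    also have "\<dots> \<longleftrightarrow> exp s * u < x i" using u by (simp add: less_divide_eq)
    finally show "indicator {exp s * u<..} (x i) = (indicator {s<..} (z i) :: real)" by (simp add: indicator_def)
  qed
  have intp: "((\<lambda>s. exceed x n (exp s * u) / real k) has_integral I) {0..L}"
    unfolding p I_def
    by (intro has_integral_divide has_integral_sum has_integral_indicator_truncation assms) auto
  have "((\<lambda>s. exp (- \<alpha> * s)) has_integral (- exp (- \<alpha> * L) / \<alpha> - - exp (- \<alpha> * 0) / \<alpha>)) {0..L}"
    using assms(1,2)
    by (intro fundamental_theorem_of_calculus)
       (auto intro!: derivative_eq_intros simp flip: has_real_derivative_iff_has_vector_derivative)
  then have "((\<lambda>s. exceed x n (exp s * u) / real k - exp (- \<alpha> * s)) has_integral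
        (I - (1 - exp (- \<alpha> * L)) / \<alpha>)) (cbox 0 L)"
    using has_integral_diff[OF intp] by (simp add: diff_divide_distrib)
  moreover have "norm (exceed x n (exp s * u) / real k - exp (- \<alpha> * s)) \<le> e1" if "s \<in> cbox 0 L" for s
  proof -
    have "1 \<le> exp s" using that by simp
    from tail[OF this] show ?thesis by (simp add: powr_def)
  qed
  moreover have "0 \<le> e1" using tail[of 1] by (meson abs_ge_zero order_refl order_trans)
  ultimately have "norm (I - (1 - exp (- \<alpha> * L)) / \<alpha>) \<le> e1 * measure lborel (cbox 0 L)"
    by (intro has_integral_bound)
  then have "\<bar>I - (1 - exp (- \<alpha> * L)) / \<alpha>\<bar> \<le> e1 * L" using assms(2) by simp
  moreover have "(1 - exp (- \<alpha> * L)) / \<alpha> = 1 / \<alpha> - exp (- \<alpha> * L) / \<alpha>" by (simp add: diff_divide_distrib)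
  moreover have "0 \<le> exp (- \<alpha> * L) / \<alpha>" using assms(1) by simp
  ultimately show ?thesis using R unfolding H by linarith
qed

text \<open>
  The good index. With \<open>k\<close> one less than the number of points above \<open>t0\<close>, the threshold \<open>u\<close> is the smallest
  point above \<open>t0\<close>. So \<open>u\<close> exceeds \<open>t0\<close>, which bounds the logarithmic excesses over \<open>u\<close> by those over the
  deterministic \<open>t0\<close>, and \<open>k\<close> is at least a quarter of \<open>n * G t0\<close>. The cut-off of \<open>hill_H_near\<close> is
  \<open>L = m * ln 2\<close>, matching \<open>m\<close> doublings of \<open>t0\<close>; the error \<open>\<rho>\<close> allowed in the Hill statistic is split into
  three equal parts.
\<close>

lemma (in rv_tail) small_KS_at_threshold:
  fixes \<delta> \<rho> e1 \<epsilon> K t0 :: real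
  assumes \<rho>: "0 < \<rho>" "\<rho> \<le> 1 / (2 * \<alpha>)" "4 * \<rho> * \<alpha> \<le> \<delta> / 2"
    and e1: "e1 \<le> \<delta> / 2" "exp (- \<alpha> * (real m * ln 2)) / \<alpha> \<le> \<rho> / 3" "e1 * (real m * ln 2) \<le> \<rho> / 3"
    and t0: "1 \<le> t0" "\<And>u y. t0 \<le> u \<Longrightarrow> 1 \<le> y \<Longrightarrow> \<bar>G (y * u) / G u - y powr - \<alpha>\<bar> \<le> e1 / 2"
    and close: "uniformly_close G x n \<epsilon> K" "0 < \<epsilon>" "\<epsilon> \<le> 1 / 2" "4 * \<epsilon> \<le> e1 / 2" "0 < K"
    and excess: "(\<Sum>i=1..n. ln (max 1 (x i / (t0 * 2 ^ m)))) \<le> \<rho> / 12 * (real n * G t0)"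
    and large: "4 \<le> real n * G t0" "8 * K / \<epsilon> \<le> real n * G t0"
    and pos: "\<And>i. i \<in> {1..n} \<Longrightarrow> 0 < x i"
  shows "\<exists>k\<in>{1..n-1}. KS_dist x n k \<le> \<delta>"
proof -
  define g where "g = real n * G t0"
  have "8 * K \<le> \<epsilon> * g" using large(2) close(2) by (simp add: g_def field_simps)
  also have "\<dots> \<le> 1 * g" using close large by (intro mult_right_mono) (auto simp: g_def)
  finally have "K \<le> g" using close(5) by simp
  then have "(1 - \<epsilon>) * g \<le> exceed x n t0"
    using close(1) unfolding uniformly_close_def g_def by blast
  moreover have "1 / 2 * g \<le> (1 - \<epsilon>) * g" using close large by (intro mult_right_mono) (auto simp: g_def)
  ultimately have N: "g / 2 \<le> exceed x n t0" by linarith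
  define k where "k = card {i\<in>{1..n}. t0 < x i} - 1"
  have k1: "exceed x n t0 = real k + 1"
    using N large(1) unfolding exceed_eq_card k_def g_def by linarith
  have kg: "g / 4 \<le> real k" "1 \<le> k"
  proof -
    show "g / 4 \<le> real k" using N k1 large(1) unfolding g_def by linarith
    have "1 \<le> real k" using N k1 large(1) unfolding g_def by linarith
    then show "1 \<le> k" by simp
  qed
  have "exceed x n t0 \<le> real n" using exceed_le_reach reach_le order_trans by blast
  then have kn: "k \<le> n - 1" using k1 by linarith
  define u where "u = order_stat x n (n - k)"
  have "\<not> u \<le> t0"
    unfolding u_def using kg kn k1 by (subst order_stat_le_iff_exceed) auto
  then have u: "t0 < u" "0 < u" using t0 by auto
  \<comment> \<open>The requirement on \<open>n\<close> is four times the one on \<open>k\<close>, as \<open>k \<ge> g / 4\<close>.\<close>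
  have "2 * K / \<epsilon> = 8 * K / \<epsilon> / 4" by simp
  also have "\<dots> \<le> g / 4" using large(2) unfolding g_def by (rule divide_right_mono) simp
  finally have Kk: "2 * K / \<epsilon> \<le> real k" using kg by linarith
  have fit: "\<bar>exceed x n (y * u) / real k - y powr - \<alpha>\<bar> \<le> e1" if y: "1 \<le> y" for y
  proof -
    have "\<bar>exceed x n (y * u) / real k - G (y * u) / G u\<bar> \<le> 4 * \<epsilon>"
      using uniformly_close_ratio[OF close(1,2,3,5) kg(2) kn Kk u_def u(2) y] .
    moreover have "\<bar>G (y * u) / G u - y powr - \<alpha>\<bar> \<le> e1 / 2" using u y by (intro t0) auto
    ultimately show ?thesis using close(4) by linarith
  qed
  have rest: "(\<Sum>i=1..n. ln (max 1 (x i / (u * exp (real m * ln 2))))) \<le> \<rho> / 3 * real k"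
  proof -
    have E: "exp (real m * ln 2) = (2::real) ^ m" by (simp add: exp_of_nat_mult)
    have "(\<Sum>i=1..n. ln (max 1 (x i / (u * exp (real m * ln 2)))))
        \<le> (\<Sum>i=1..n. ln (max 1 (x i / (t0 * 2 ^ m))))"
    proof (intro sum_mono)
      fix i assume "i \<in> {1..n}"
      then have "0 < x i" by (rule pos)
      then have "x i / (u * 2 ^ m) \<le> x i / (t0 * 2 ^ m)"
        using u t0 by (intro divide_left_mono mult_right_mono) auto
      then show "ln (max 1 (x i / (u * exp (real m * ln 2)))) \<le> ln (max 1 (x i / (t0 * 2 ^ m)))"
        unfolding E by (subst ln_le_cancel_iff) auto
    qed
    also have "\<dots> \<le> \<rho> / 12 * g" using excess by (simp only: g_def)
    also have "\<dots> = \<rho> / 3 * (g / 4)" by simp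
    also have "\<dots> \<le> \<rho> / 3 * real k" using kg \<rho> by (intro mult_left_mono) auto
    finally show ?thesis .
  qed
  have "\<bar>hill_H x n k - 1 / \<alpha>\<bar> \<le> exp (- \<alpha> * (real m * ln 2)) / \<alpha> + e1 * (real m * ln 2) + \<rho> / 3"
    using alpha_pos _ kg(2) kn pos u_def u(2) fit rest by (rule hill_H_near) simp_all
  then have H: "\<bar>hill_H x n k - 1 / \<alpha>\<bar> \<le> \<rho>" using e1 by linarith
  have "KS_dist x n k \<le> \<delta>"
  proof (rule KS_dist_le[OF kg(2) kn])
    show "0 < order_stat x n (n - k)" using u by (simp add: u_def)
    fix y :: real assume y: "1 \<le> y"
    have "\<bar>y powr - alpha_hat x n k - y powr - \<alpha>\<bar> \<le> 4 * \<rho> * \<alpha>"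
      unfolding alpha_hat_def using alpha_pos H \<rho>(2) y by (rule powr_inverse_diff)
    then show "\<bar>exceed x n (y * order_stat x n (n - k)) / real k - y powr - alpha_hat x n k\<bar> \<le> \<delta>"
      using fit[OF y] e1(1) \<rho>(3) unfolding u_def by linarith
  qed
  then show ?thesis using kg kn by auto
qed

section \<open>Independent samples\<close>

text \<open>
  In the union bound over the grid, the terms increase geometrically up to the last admissible \<open>j\<close>, so
  the sum is comparable to its last term, whatever the value of \<open>C\<close> is; later \<open>C\<close> is the sample size.
\<close>

lemma geometric_grid_sum:
  fixes q c C :: real
  assumes q: "0 < q" "q < 1" and c: "0 < c" and C: "0 < C"
  shows "finite {j. c \<le> C * q ^ j}" "(\<Sum>j | c \<le> C * q ^ j. 1 / (C * q ^ j)) \<le> 1 / (c * (1 - q))"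
proof -
  let ?J = "{j. c \<le> C * q ^ j}"
  obtain N where N: "q ^ N < c / C" using real_arch_pow_inv[of "c / C" q] q c C by auto
  have "j < N" if "j \<in> ?J" for j
  proof (rule ccontr)
    assume "\<not> j < N"
    then have "q ^ j \<le> q ^ N" using q by (intro power_decreasing) auto
    then have "q ^ j < c / C" using N by linarith
    then have "C * q ^ j < c" using C by (simp add: field_simps)
    then show False using that by simp
  qed
  then show fin: "finite ?J" by (intro finite_subset[of ?J "{..<N}"]) auto
  show "(\<Sum>j | c \<le> C * q ^ j. 1 / (C * q ^ j)) \<le> 1 / (c * (1 - q))"
  proof (cases "?J = {}")
    case True
    then show ?thesis using q c by simp
  next
    case False
    define m where "m = Max ?J"
    have m: "c \<le> C * q ^ m" using Max_in[OF fin False] by (simp add: m_def)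
    have "(\<Sum>j\<in>?J. 1 / (C * q ^ j)) \<le> (\<Sum>j\<in>?J. q ^ (m - j) / c)"
    proof (intro sum_mono)
      fix j assume "j \<in> ?J"
      then have "j \<le> m" using Max_ge[OF fin] by (simp add: m_def)
      then have "C * q ^ m = (C * q ^ j) * q ^ (m - j)" by (simp flip: power_add)
      then show "1 / (C * q ^ j) \<le> q ^ (m - j) / c"
        using m c C q by (simp add: field_simps)
    qed
    also have "\<dots> \<le> (\<Sum>j\<le>m. q ^ (m - j) / c)"
      using Max_ge[OF fin] q c by (intro sum_mono2) (auto simp: m_def)
    also have "\<dots> = (\<Sum>i\<le>m. q ^ i) / c"
      unfolding sum_divide_distrib[symmetric] by (intro arg_cong2[where f="(/)"] refl sum.reindex_bij_witness[of _ "\<lambda>i. m - i" "\<lambda>i. m - i"]) auto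
    also have "\<dots> \<le> 1 / (1 - q) / c"
    proof (intro divide_right_mono)
      have "(\<Sum>i\<le>m. q ^ i) \<le> (\<Sum>i. q ^ i)"
        using q by (intro sum_le_suminf summable_geometric) auto
      then show "(\<Sum>i\<le>m. q ^ i) \<le> 1 / (1 - q)" using q by (simp add: suminf_geometric)
    qed (use c in auto)
    finally show ?thesis by (simp add: mult.commute)
  qed
qed

text \<open>
  Used to bound a logarithmic moment by tail probabilities along doublings of \<open>s\<close>. The right-hand side is
  the number of \<open>j\<close> with \<open>2 ^ j * s < x\<close>, which is at least \<open>ln (x / s)\<close> as \<open>2 \<le> exp 1\<close>.
\<close>

lemma ln_le_dyadic_count:
  fixes x s :: real
  assumes "0 < s"
  shows "ennreal (ln (max 1 (x / s))) \<le> (\<Sum>j::nat. indicator {2 ^ j * s<..} x)"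
proof (cases "s < x")
  case False
  then have "max 1 (x / s) = 1" using assms by (simp add: max_def field_simps)
  then show ?thesis by simp
next
  case True
  define z where "z = ln (x / s)"
  have xs: "1 < x / s" using True assms by (simp add: field_simps)
  have z: "0 < z" "ln (max 1 (x / s)) = z" using xs by (auto simp: z_def)
  define N where "N = nat \<lceil>z\<rceil>"
  have "z \<le> real N" using z unfolding N_def by linarith
  have ind: "indicator {2 ^ j * s<..} x = (1 :: ennreal)" if "j < N" for j
  proof -
    have "real j < z" using that z unfolding N_def by linarith
    have "(2::real) ^ j \<le> exp 1 ^ j" using exp_ge_add_one_self[of 1] by (intro power_mono) auto
    also have "\<dots> = exp (real j)" by (simp flip: exp_of_nat_mult)
    also have "\<dots> < exp z" using \<open>real j < z\<close> by simp
    also have "\<dots> = x / s" using xs by (simp add: z_def)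
    finally show ?thesis using assms by (simp add: indicator_def field_simps)
  qed
  have "ennreal z \<le> ennreal (real N)" using \<open>z \<le> real N\<close> by (rule ennreal_leI)
  also have "\<dots> = (\<Sum>j<N. indicator {2 ^ j * s<..} x)" by (simp add: ind ennreal_of_nat_eq_real_of_nat)
  also have "\<dots> \<le> (\<Sum>j. indicator {2 ^ j * s<..} x)" by (intro sum_le_suminf summableI) auto
  finally show ?thesis using z by simp
qed

locale rv_sample = rv_tail G \<alpha> + prob_space M
  for G :: "real \<Rightarrow> real" and \<alpha> :: real and M :: "'a measure" +
  fixes X :: "nat \<Rightarrow> 'a \<Rightarrow> real"
  assumes indep: "indep_vars (\<lambda>_. borel) X {1..}"
    and tail: "\<And>i t. 1 \<le> i \<Longrightarrow> prob {\<omega> \<in> space M. t < X i \<omega>} = G t"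
begin

lemma X_measurable [measurable]: "1 \<le> i \<Longrightarrow> X i \<in> borel_measurable M"
  using indep by (simp add: indep_vars_def)

lemma exceed_measurable [measurable]: "(\<lambda>\<omega>. exceed (\<lambda>i. X i \<omega>) n t) \<in> borel_measurable M"
  unfolding exceed_def by (intro borel_measurable_sum) measurable

lemma tail_integral:
  assumes "1 \<le> i"
  shows "expectation (\<lambda>\<omega>. indicator {t<..} (X i \<omega>)) = G t"
proof -
  have "expectation (\<lambda>\<omega>. indicator {t<..} (X i \<omega>)) = expectation (indicator {\<omega> \<in> space M. t < X i \<omega>})"
    by (intro Bochner_Integration.integral_cong) (auto simp: indicator_def)
  also have "\<dots> = prob ({\<omega> \<in> space M. t < X i \<omega>} \<inter> space M)" by simp
  also have "{\<omega> \<in> space M. t < X i \<omega>} \<inter> space M = {\<omega> \<in> space M. t < X i \<omega>}" by blast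
  finally show ?thesis by (simp only: tail[OF assms])
qed

lemma tail_integrable: "1 \<le> i \<Longrightarrow> integrable M (\<lambda>\<omega>. indicator {t<..} (X i \<omega>) :: real)"
  by (intro integrable_const_bound[where B = 1]) (auto simp: indicator_def)

lemma pair_integrable:
  "1 \<le> i \<Longrightarrow> 1 \<le> j \<Longrightarrow> integrable M (\<lambda>\<omega>. indicator {t<..} (X i \<omega>) * indicator {t<..} (X j \<omega>) :: real)"
  by (intro integrable_const_bound[where B = 1]) (auto simp: indicator_def)

lemma pair_integral:
  assumes "1 \<le> i" "1 \<le> j" "i \<noteq> j"
  shows "expectation (\<lambda>\<omega>. indicator {t<..} (X i \<omega>) * indicator {t<..} (X j \<omega>)) = G t * G t"
proof -
  have "indep_vars (\<lambda>_. borel) X {i, j}" using assms by (intro indep_vars_subset[OF indep]) auto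
  then have "indep_vars (\<lambda>_. borel) (\<lambda>k \<omega>. indicator {t<..} (X k \<omega>) :: real) {i, j}"
    by (rule indep_vars_compose2) auto
  then have "expectation (\<lambda>\<omega>. \<Prod>k\<in>{i, j}. indicator {t<..} (X k \<omega>) :: real) =
      (\<Prod>k\<in>{i, j}. expectation (\<lambda>\<omega>. indicator {t<..} (X k \<omega>)))"
    using assms by (intro indep_vars_lebesgue_integral) (auto intro: tail_integrable)
  then show ?thesis using assms by (simp add: tail_integral)
qed

lemma exceed_expectation: "expectation (\<lambda>\<omega>. exceed (\<lambda>i. X i \<omega>) n t) = real n * G t"
  unfolding exceed_def by (subst Bochner_Integration.integral_sum) (auto simp: tail_integral intro: tail_integrable)

lemma exceed_square:
  "(exceed x n t)\<^sup>2 = (\<Sum>i=1..n. \<Sum>j=1..n. indicator {t<..} (x i) * indicator {t<..} (x j))"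
  by (simp add: exceed_def power2_eq_square sum_product)

lemma exceed_square_integrable: "integrable M (\<lambda>\<omega>. (exceed (\<lambda>i. X i \<omega>) n t)\<^sup>2)"
  unfolding exceed_square by (intro Bochner_Integration.integrable_sum pair_integrable) auto

text \<open>
  Pairwise independence makes the covariances vanish, and an indicator has a variance of at most its mean.
\<close>

lemma exceed_variance: "variance (\<lambda>\<omega>. exceed (\<lambda>i. X i \<omega>) n t) \<le> real n * G t"
proof -
  have int: "integrable M (\<lambda>\<omega>. exceed (\<lambda>i. X i \<omega>) n t)"
    unfolding exceed_def by (intro Bochner_Integration.integrable_sum tail_integrable) auto
  have "expectation (\<lambda>\<omega>. (exceed (\<lambda>i. X i \<omega>) n t)\<^sup>2)
      = (\<Sum>i=1..n. expectation (\<lambda>\<omega>. \<Sum>j=1..n. indicator {t<..} (X i \<omega>) * indicator {t<..} (X j \<omega>)))"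
    unfolding exceed_square
    by (intro Bochner_Integration.integral_sum Bochner_Integration.integrable_sum pair_integrable) auto
  also have "\<dots> = (\<Sum>i=1..n. \<Sum>j=1..n. expectation (\<lambda>\<omega>. indicator {t<..} (X i \<omega>) * indicator {t<..} (X j \<omega>)))"
    by (intro sum.cong refl Bochner_Integration.integral_sum pair_integrable) auto
  also have "\<dots> \<le> (\<Sum>i=1..n. \<Sum>j=1..n. G t * G t + (if i = j then G t else 0))"
  proof (intro sum_mono)
    fix i j assume ij: "i \<in> {1..n}" "j \<in> {1..n}"
    show "expectation (\<lambda>\<omega>. indicator {t<..} (X i \<omega>) * indicator {t<..} (X j \<omega>))
       \<le> G t * G t + (if i = j then G t else 0)"
    proof (cases "i = j")
      case True
      have "expectation (\<lambda>\<omega>. indicator {t<..} (X i \<omega>) * indicator {t<..} (X i \<omega>)) = G t"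
        using tail_integral[of i t] ij by (simp flip: indicator_inter_arith)
      then show ?thesis using True by simp
    qed (use ij pair_integral[of i j t] in auto)
  qed
  also have "\<dots> = (real n * G t)\<^sup>2 + real n * G t"
    by (simp add: sum.distrib power2_eq_square algebra_simps)
  finally show ?thesis
    by (subst variance_eq[OF int exceed_square_integrable]) (simp add: exceed_expectation)
qed

lemma exceed_deviation:
  assumes "0 < d" "0 < n"
  shows "prob {\<omega> \<in> space M. d * (real n * G t) \<le> \<bar>exceed (\<lambda>i. X i \<omega>) n t - real n * G t\<bar>}
    \<le> 1 / (d\<^sup>2 * (real n * G t))"
proof -
  have pos: "0 < real n * G t" using assms G_pos[of t] by simp
  have "prob {\<omega> \<in> space M. d * (real n * G t) \<le> \<bar>exceed (\<lambda>i. X i \<omega>) n t - real n * G t\<bar>}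
     \<le> variance (\<lambda>\<omega>. exceed (\<lambda>i. X i \<omega>) n t) / (d * (real n * G t))\<^sup>2"
    using Chebyshev_inequality[of "\<lambda>\<omega>. exceed (\<lambda>i. X i \<omega>) n t" "d * (real n * G t)"]
      assms pos exceed_square_integrable by (simp add: exceed_expectation)
  also have "\<dots> \<le> (real n * G t) / (d * (real n * G t))\<^sup>2"
    by (intro divide_right_mono exceed_variance) auto
  also have "\<dots> = 1 / (d\<^sup>2 * (real n * G t))"
    using pos assms by (simp add: power_mult_distrib power2_eq_square)
  finally show ?thesis .
qed

text \<open>
  At the grid point \<open>T j\<close> Chebyshev's inequality bounds the probability of a relative error \<open>d\<close> by
  \<open>1 / (d^2 * n * q ^ j)\<close>. The sum over the relevant \<open>j\<close> is of the order \<open>1 / K\<close> with a constant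
  independent of \<open>n\<close>.
\<close>

lemma uniformly_close_prob:
  assumes e: "0 < e" "e \<le> 1" and \<zeta>: "0 < \<zeta>"
  shows "\<exists>K>0. \<forall>n>0. \<exists>B\<in>events. prob B \<le> \<zeta> \<and>
    (\<forall>\<omega>\<in>space M - B. uniformly_close G (\<lambda>i. X i \<omega>) n e K)"
proof -
  define d where "d = e / 7"
  have d: "0 < d" "d \<le> 1" using e by (auto simp: d_def)
  define q where "q = 1 / (1 + d)"
  have q: "0 < q" "q < 1" using d by (auto simp: q_def)
  have "\<exists>t. G t = q ^ j" for j using q by (intro G_attains) (auto intro: power_le_one)
  then obtain T where T: "\<And>j. G (T j) = q ^ j" by metis
  \<comment> \<open>The total of the Chebyshev bounds is then exactly \<open>\<zeta>\<close>.\<close>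
  define K where "K = 1 / (d\<^sup>2 * q * (1 - q) * \<zeta>)"
  have K: "0 < K" using d q \<zeta> by (simp add: K_def)
  have "\<exists>B\<in>events. prob B \<le> \<zeta> \<and> (\<forall>\<omega>\<in>space M - B. uniformly_close G (\<lambda>i. X i \<omega>) n e K)"
    if n: "0 < n" for n :: nat
  proof -
    define J where "J = {j. q * K \<le> real n * q ^ j}"
    define A where "A j = {\<omega> \<in> space M. d * (real n * G (T j)) \<le> \<bar>exceed (\<lambda>i. X i \<omega>) n (T j) - real n * G (T j)\<bar>}" for j
    have A: "A j \<in> events" for j unfolding A_def by measurable
    have J: "finite J" "(\<Sum>j\<in>J. 1 / (real n * q ^ j)) \<le> 1 / (q * K * (1 - q))"
      unfolding J_def using geometric_grid_sum[of q "q * K" "real n"] q K n by auto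
    have "prob (\<Union>j\<in>J. A j) \<le> (\<Sum>j\<in>J. prob (A j))"
      using J A by (intro finite_measure_subadditive_finite) auto
    also have "\<dots> \<le> (\<Sum>j\<in>J. 1 / d\<^sup>2 * (1 / (real n * q ^ j)))"
    proof (intro sum_mono)
      fix j
      show "prob (A j) \<le> 1 / d\<^sup>2 * (1 / (real n * q ^ j))"
        using exceed_deviation[OF d(1) n, of "T j"] unfolding A_def T by simp
    qed
    also have "\<dots> \<le> 1 / d\<^sup>2 * (1 / (q * K * (1 - q)))"
      unfolding sum_distrib_left[symmetric] using J d by (intro mult_left_mono) auto
    also have "\<dots> = \<zeta>" using d q \<zeta> by (simp add: K_def)
    finally have "prob (\<Union>j\<in>J. A j) \<le> \<zeta>" .
    moreover have "uniformly_close G (\<lambda>i. X i \<omega>) n e K" if "\<omega> \<in> space M - (\<Union>j\<in>J. A j)" for \<omega>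
    proof -
      have "uniformly_close G (\<lambda>i. X i \<omega>) n (7 * d) K"
        using d(1,2) q_def T n by (rule uniformly_close_from_grid) (use that in \<open>auto simp: J_def A_def T\<close>)
      then show ?thesis by (simp add: d_def)
    qed
    moreover have "(\<Union>j\<in>J. A j) \<in> events" using J A by auto
    ultimately show ?thesis by blast
  qed
  then show ?thesis using K by blast
qed

text \<open>
  Markov's inequality for the sum of the logarithmic excesses over \<open>t0 * 2 ^ m\<close>. Its mean is bounded by
  the geometric series that the doubling bound yields. The resulting bound does not depend on
  \<open>n\<close>; it is made small by the choice of \<open>m\<close>. The maximum with \<open>1\<close> takes the positive part of the logarithm.
\<close>

lemma log_excess_prob:
  fixes r c :: real
  assumes r: "0 < r" "r < 1" and t0: "0 < t0" "\<And>j::nat. G (2 ^ j * t0) \<le> r ^ j * G t0"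
    and c: "0 < c" and n: "0 < n"
  shows "prob {\<omega> \<in> space M. c * (real n * G t0) \<le> (\<Sum>i=1..n. ln (max 1 (X i \<omega> / (t0 * 2 ^ m))))}
     \<le> r ^ m / ((1 - r) * c)"
proof -
  define s where "s = t0 * 2 ^ m"
  have s: "0 < s" using t0 by (simp add: s_def)
  define Y where "Y i \<omega> = ln (max 1 (X i \<omega> / s))" for i \<omega>
  define b where "b = r ^ m * G t0 / (1 - r)"
  have b: "0 \<le> b" using r G_nonneg by (simp add: b_def)
  have Y0: "0 \<le> Y i \<omega>" for i \<omega> by (simp add: Y_def)
  have nn: "(\<integral>\<^sup>+\<omega>. ennreal (Y i \<omega>) \<partial>M) \<le> ennreal b" if i: "1 \<le> i" for i
  proof -
    have [measurable]: "X i \<in> borel_measurable M" using i by measurable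
    have "(\<integral>\<^sup>+\<omega>. ennreal (Y i \<omega>) \<partial>M) \<le> (\<integral>\<^sup>+\<omega>. (\<Sum>j. indicator {2 ^ j * s<..} (X i \<omega>)) \<partial>M)"
      unfolding Y_def by (intro nn_integral_mono ln_le_dyadic_count s)
    also have "\<dots> = (\<Sum>j. \<integral>\<^sup>+\<omega>. indicator {2 ^ j * s<..} (X i \<omega>) \<partial>M)"
      by (intro nn_integral_suminf) measurable
    also have "\<dots> = (\<Sum>j. ennreal (G (2 ^ j * s)))"
    proof (intro suminf_cong)
      fix j
      have "(\<integral>\<^sup>+\<omega>. indicator {2 ^ j * s<..} (X i \<omega>) \<partial>M) =
         (\<integral>\<^sup>+\<omega>. indicator {\<omega> \<in> space M. 2 ^ j * s < X i \<omega>} \<omega> \<partial>M)"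
        by (intro nn_integral_cong) (auto simp: indicator_def)
      also have "\<dots> = emeasure M {\<omega> \<in> space M. 2 ^ j * s < X i \<omega>}"
        by (intro nn_integral_indicator) measurable
      finally show "(\<integral>\<^sup>+\<omega>. indicator {2 ^ j * s<..} (X i \<omega>) \<partial>M) = ennreal (G (2 ^ j * s))"
        using tail[OF i] by (simp add: emeasure_eq_measure)
    qed
    also have "\<dots> \<le> (\<Sum>j. ennreal (r ^ j * (r ^ m * G t0)))"
    proof (intro suminf_le ennreal_leI summableI)
      fix j
      have "2 ^ j * s = 2 ^ (j + m) * t0" by (simp add: s_def power_add)
      then show "G (2 ^ j * s) \<le> r ^ j * (r ^ m * G t0)"
        using t0(2)[of "j + m"] by (simp only: power_add mult.assoc)
    qed
    also have "\<dots> = ennreal (1 / (1 - r) * (r ^ m * G t0))"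
      using r G_nonneg by (intro suminf_ennreal_eq sums_mult2 geometric_sums) auto
    finally show ?thesis by (simp add: b_def)
  qed
  have [measurable]: "Y i \<in> borel_measurable M" if "1 \<le> i" for i
  proof -
    have [measurable]: "X i \<in> borel_measurable M" using that by measurable
    show ?thesis unfolding Y_def by measurable
  qed
  have intY: "integrable M (Y i)" if "1 \<le> i" for i
  proof (rule integrableI_bounded)
    show "(\<integral>\<^sup>+\<omega>. ennreal (norm (Y i \<omega>)) \<partial>M) < \<infinity>"
      using nn[OF that] Y0 by (auto intro: le_less_trans)
  qed (use that in measurable)
  have EY: "expectation (Y i) \<le> b" if "1 \<le> i" for i
    using nn[OF that] b nn_integral_eq_integral[OF intY[OF that]] Y0 by (simp add: ennreal_le_iff)
  have "expectation (\<lambda>\<omega>. \<Sum>i=1..n. Y i \<omega>) = (\<Sum>i=1..n. expectation (Y i))"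
    by (intro Bochner_Integration.integral_sum intY) auto
  also have "\<dots> \<le> (\<Sum>i=1..n. b)" by (intro sum_mono EY) auto
  finally have ES: "expectation (\<lambda>\<omega>. \<Sum>i=1..n. Y i \<omega>) \<le> n * b" by simp
  have pos: "0 < c * (real n * G t0)" using c n G_pos by simp
  have "prob {\<omega> \<in> space M. c * (real n * G t0) \<le> (\<Sum>i=1..n. Y i \<omega>)}
      \<le> expectation (\<lambda>\<omega>. \<Sum>i=1..n. Y i \<omega>) / (c * (real n * G t0))"
    using pos by (intro integral_Markov_inequality_measure[where A = "{}"] Bochner_Integration.integrable_sum intY)
      (auto intro!: sum_nonneg Y0)
  also have "\<dots> \<le> n * b / (c * (real n * G t0))"
    using ES pos by (intro divide_right_mono) auto
  also have "\<dots> = r ^ m / ((1 - r) * c)"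
    using n G_pos[of t0] by (simp add: b_def)
  finally show ?thesis by (simp add: Y_def s_def)
qed

end

section \<open>Consistency\<close>

context rv_sample
begin

text \<open>
  The constants are chosen in an order that avoids circularity: \<open>\<rho>\<close> from \<open>\<delta>\<close>, then the number \<open>m\<close> of
  doublings making the cut-off errors small, then the accuracy \<open>e1\<close> of the empirical tail, which has to be
  small relative to the length \<open>L\<close> of the range of integration, then the level \<open>t0\<close> and the constant
  \<open>K\<close>, and finally \<open>n\<close>.
\<close>

lemma small_KS_prob:
  assumes \<delta>: "0 < \<delta>" and \<zeta>: "0 < \<zeta>"
  shows "\<exists>n0. \<forall>n\<ge>n0. \<exists>B\<in>events. prob B \<le> \<zeta> \<and>
    (\<forall>\<omega>\<in>space M - B. (\<forall>i\<in>{1..n}. 0 < X i \<omega>) \<longrightarrow> (\<exists>k\<in>{1..n-1}. KS_dist (\<lambda>i. X i \<omega>) n k \<le> \<delta>))"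
proof -
  define \<rho> where "\<rho> = min (1 / (2 * \<alpha>)) (\<delta> / (8 * \<alpha>))"
  have "0 < \<rho>" using \<delta> alpha_pos by (simp add: \<rho>_def)
  moreover have "\<rho> \<le> 1 / (2 * \<alpha>)" by (simp add: \<rho>_def)
  moreover have "4 * \<rho> * \<alpha> \<le> \<delta> / 2"
  proof -
    have "\<rho> \<le> \<delta> / (8 * \<alpha>)" by (simp add: \<rho>_def)
    then show ?thesis using alpha_pos by (simp add: field_simps)
  qed
  ultimately have \<rho>: "0 < \<rho>" "\<rho> \<le> 1 / (2 * \<alpha>)" "4 * \<rho> * \<alpha> \<le> \<delta> / 2" .
  define r where "r = 2 powr (- \<alpha> / 2)"
  have r: "0 < r" "r < 1" using alpha_pos by (auto simp: r_def powr_less_one)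
  define c where "c = \<rho> / 12"
  have c: "0 < c" using \<rho> by (simp add: c_def)
  have "0 < min (\<zeta> / 2 * ((1 - r) * c)) (\<rho> / 3 * \<alpha>)" using \<zeta> r c \<rho> alpha_pos by simp
  then obtain m where m: "r ^ m < min (\<zeta> / 2 * ((1 - r) * c)) (\<rho> / 3 * \<alpha>)"
    using real_arch_pow_inv r(2) by blast
  have m1: "r ^ m / ((1 - r) * c) \<le> \<zeta> / 2" using m r c by (simp add: divide_le_eq)
  define L where "L = real m * ln 2"
  have L: "0 \<le> L" by (simp add: L_def)
  have m2: "exp (- \<alpha> * L) / \<alpha> \<le> \<rho> / 3"
  proof -
    have "r ^ m = exp (- \<alpha> / 2 * L)"
      by (simp add: r_def powr_def L_def flip: exp_of_nat_mult)
    moreover have "exp (- \<alpha> * L) \<le> exp (- \<alpha> / 2 * L)"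
      using alpha_pos L by (simp add: mult_right_mono)
    moreover have "r ^ m < \<rho> / 3 * \<alpha>" using m by simp
    ultimately have "exp (- \<alpha> * L) \<le> \<rho> / 3 * \<alpha>" by linarith
    then show ?thesis using alpha_pos by (simp add: divide_le_eq)
  qed
  define e1 where "e1 = min (\<delta> / 2) (\<rho> / (3 * (L + 1)))"
  have "0 < e1" using \<delta> \<rho> L by (simp add: e1_def)
  moreover have "e1 \<le> \<delta> / 2" unfolding e1_def by (rule min.cobounded1)
  moreover have "e1 * L \<le> \<rho> / 3"
  proof -
    have "e1 * L \<le> \<rho> / (3 * (L + 1)) * (L + 1)"
      using L \<rho> by (intro mult_mono) (auto simp: e1_def)
    also have "\<dots> = \<rho> / 3" using L by (simp add: field_simps)
    finally show ?thesis .
  qed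
  ultimately have e1: "0 < e1" "e1 \<le> \<delta> / 2" "e1 * L \<le> \<rho> / 3" .
  obtain t1 where t1: "1 \<le> t1" "\<And>t j. t1 \<le> t \<Longrightarrow> G (2 ^ j * t) \<le> r ^ j * G t"
    using doubling unfolding r_def by blast
  obtain t2 where t2: "1 \<le> t2" "\<And>u y. t2 \<le> u \<Longrightarrow> 1 \<le> y \<Longrightarrow> \<bar>G (y * u) / G u - y powr - \<alpha>\<bar> \<le> e1 / 2"
    using ratio_uniform[of "e1 / 2"] e1(1) by auto
  define t0 where "t0 = max t1 t2"
  have t0: "1 \<le> t0" "t1 \<le> t0" "t2 \<le> t0" using t1 by (auto simp: t0_def)
  define \<epsilon> where "\<epsilon> = min (1 / 2) (e1 / 8)"
  have \<epsilon>: "0 < \<epsilon>" "\<epsilon> \<le> 1 / 2" "4 * \<epsilon> \<le> e1 / 2" using e1 by (auto simp: \<epsilon>_def)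
  obtain K where K: "0 < K" "\<And>n. 0 < n \<Longrightarrow> \<exists>B\<in>events. prob B \<le> \<zeta> / 2 \<and>
      (\<forall>\<omega>\<in>space M - B. uniformly_close G (\<lambda>i. X i \<omega>) n \<epsilon> K)"
    using uniformly_close_prob[of \<epsilon> "\<zeta> / 2"] \<epsilon> \<zeta> by auto
  obtain n0 where n0: "max 4 (8 * K / \<epsilon>) / G t0 < real n0" using reals_Archimedean2 by blast
  show ?thesis
  proof (intro exI allI impI)
    fix n assume n: "n0 \<le> n"
    have "max 4 (8 * K / \<epsilon>) / G t0 < real n" using n0 n by linarith
    then have "max 4 (8 * K / \<epsilon>) < real n * G t0" using G_pos[of t0] by (simp add: divide_less_eq)
    then have large: "4 \<le> real n * G t0" "8 * K / \<epsilon> \<le> real n * G t0" by auto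
    have npos: "0 < n" using large(1) by (cases n) auto
    obtain B1 where B1: "B1 \<in> events" "prob B1 \<le> \<zeta> / 2"
      "\<And>\<omega>. \<omega> \<in> space M - B1 \<Longrightarrow> uniformly_close G (\<lambda>i. X i \<omega>) n \<epsilon> K"
      using K(2)[OF npos] by auto
    define B2 where "B2 = {\<omega> \<in> space M. c * (real n * G t0) \<le> (\<Sum>i=1..n. ln (max 1 (X i \<omega> / (t0 * 2 ^ m))))}"
    have "(\<lambda>\<omega>. \<Sum>i=1..n. ln (max 1 (X i \<omega> / (t0 * 2 ^ m)))) \<in> borel_measurable M"
      by (intro borel_measurable_sum) (auto intro!: borel_measurable_ln borel_measurable_max borel_measurable_divide)
    then have B2: "B2 \<in> events" unfolding B2_def by measurable
    have "prob B2 \<le> r ^ m / ((1 - r) * c)"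
      unfolding B2_def using r t0 t1 c npos by (intro log_excess_prob) auto
    then have "prob B2 \<le> \<zeta> / 2" using m1 by linarith
    then have "prob (B1 \<union> B2) \<le> \<zeta>"
      using measure_Un_le[OF B1(1) B2] B1(2) by linarith
    moreover have "\<exists>k\<in>{1..n-1}. KS_dist (\<lambda>i. X i \<omega>) n k \<le> \<delta>"
      if \<omega>: "\<omega> \<in> space M - (B1 \<union> B2)" and pos: "\<And>i. i \<in> {1..n} \<Longrightarrow> 0 < X i \<omega>" for \<omega>
    proof (rule small_KS_at_threshold[OF \<rho>])
      show "e1 \<le> \<delta> / 2" by fact
      show "exp (- \<alpha> * (real m * ln 2)) / \<alpha> \<le> \<rho> / 3" using m2 by (simp only: L_def)
      show "e1 * (real m * ln 2) \<le> \<rho> / 3" using e1(3) by (simp only: L_def)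
      show "uniformly_close G (\<lambda>i. X i \<omega>) n \<epsilon> K" using \<omega> by (intro B1(3)) auto
      show "(\<Sum>i=1..n. ln (max 1 (X i \<omega> / (t0 * 2 ^ m)))) \<le> \<rho> / 12 * (real n * G t0)"
        using \<omega> unfolding B2_def c_def by auto
      show "\<bar>G (y * u) / G u - y powr - \<alpha>\<bar> \<le> e1 / 2" if "t0 \<le> u" "1 \<le> y" for u y
        using that t0 by (intro t2) auto
    qed (use t0 \<epsilon> K large pos in auto)
    ultimately show "\<exists>B\<in>events. prob B \<le> \<zeta> \<and>
        (\<forall>\<omega>\<in>space M - B. (\<forall>i\<in>{1..n}. 0 < X i \<omega>) \<longrightarrow> (\<exists>k\<in>{1..n-1}. KS_dist (\<lambda>i. X i \<omega>) n k \<le> \<delta>))"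
      using B1(1) B2 by (intro bexI[of _ "B1 \<union> B2"]) auto
  qed
qed

text \<open>
  Continuity of the distribution function enters through \<open>G 1 = 1\<close>, which excludes an atom at \<open>1\<close> and makes
  all points larger than \<open>1\<close> almost surely.
\<close>

lemma AE_sample_ge_1: "AE \<omega> in M. \<forall>i\<ge>1. 1 \<le> X i \<omega>"
proof -
  have "AE \<omega> in M. 1 \<le> i \<longrightarrow> 1 \<le> X i \<omega>" for i
  proof (cases "1 \<le> i")
    case True
    have [measurable]: "X i \<in> borel_measurable M" using True by measurable
    have "prob {\<omega> \<in> space M. 1 < X i \<omega>} = 1" using tail[OF True, of 1] G_1[of 1] by simp
    then have "AE \<omega> in M. \<omega> \<in> {\<omega> \<in> space M. 1 < X i \<omega>}"
      by (subst prob_eq_1[symmetric]) measurable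
    then show ?thesis by (rule AE_mp) auto
  qed simp
  then show ?thesis by (simp add: AE_all_countable)
qed

text \<open>
  With high probability the minimal distance is below \<open>d\<close>. The part \<open>d \<le> e / (4 * K)\<close> forces the
  minimizer to be so large that the empirical tail above its threshold is close to the true one; the part
  \<open>d \<le> \<delta> / 2\<close> makes the fitted power close to the true tail, which identifies the exponent.
\<close>

lemma PLFit_deviation_prob:
  assumes \<eta>: "0 < \<eta>" and \<zeta>: "0 < \<zeta>"
  shows "\<exists>n0. \<forall>n\<ge>n0. prob {\<omega> \<in> space M. \<eta> < \<bar>PLFit (\<lambda>i. X i \<omega>) n - \<alpha>\<bar>} \<le> \<zeta>"
proof -
  obtain \<delta> where \<delta>: "0 < \<delta>"
    "\<And>u a. 1 \<le> u \<Longrightarrow> (\<And>y. 1 \<le> y \<Longrightarrow> \<bar>G (y * u) / G u - y powr - a\<bar> \<le> \<delta>) \<Longrightarrow> \<bar>a - \<alpha>\<bar> \<le> \<eta>"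
    using index_identified[OF \<eta>] by blast
  define e where "e = min (1 / 2) (\<delta> / 8)"
  have e: "0 < e" "e \<le> 1 / 2" "4 * e \<le> \<delta> / 2" using \<delta>(1) by (auto simp: e_def)
  obtain K where K: "0 < K" "\<And>n. 0 < n \<Longrightarrow> \<exists>B\<in>events. prob B \<le> \<zeta> / 2 \<and>
      (\<forall>\<omega>\<in>space M - B. uniformly_close G (\<lambda>i. X i \<omega>) n e K)"
    using uniformly_close_prob[of e "\<zeta> / 2"] e \<zeta> by auto
  define d where "d = min (\<delta> / 2) (e / (4 * K))"
  have d: "0 < d" "d \<le> \<delta> / 2" "d \<le> e / (4 * K)" using \<delta> e K by (auto simp: d_def)
  obtain n0 where n0: "\<And>n. n0 \<le> n \<Longrightarrow> \<exists>B\<in>events. prob B \<le> \<zeta> / 2 \<and>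
    (\<forall>\<omega>\<in>space M - B. (\<forall>i\<in>{1..n}. 0 < X i \<omega>) \<longrightarrow> (\<exists>k\<in>{1..n-1}. KS_dist (\<lambda>i. X i \<omega>) n k \<le> d))"
    using small_KS_prob[OF d(1), of "\<zeta> / 2"] \<zeta> by auto
  obtain N where N: "N \<in> null_sets M" "{\<omega> \<in> space M. \<not> (\<forall>i\<ge>1. 1 \<le> X i \<omega>)} \<subseteq> N"
    using AE_sample_ge_1 by (auto simp: eventually_ae_filter)
  show ?thesis
  proof (intro exI allI impI)
    fix n assume n: "max n0 2 \<le> n"
    obtain B1 where B1: "B1 \<in> events" "prob B1 \<le> \<zeta> / 2"
      "\<And>\<omega>. \<omega> \<in> space M - B1 \<Longrightarrow> uniformly_close G (\<lambda>i. X i \<omega>) n e K"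
      using K(2)[of n] n by auto
    obtain B2 where B2: "B2 \<in> events" "prob B2 \<le> \<zeta> / 2"
      "\<And>\<omega>. \<omega> \<in> space M - B2 \<Longrightarrow> (\<forall>i\<in>{1..n}. 0 < X i \<omega>) \<Longrightarrow> \<exists>k\<in>{1..n-1}. KS_dist (\<lambda>i. X i \<omega>) n k \<le> d"
      using n0[of n] n by auto
    have "\<bar>PLFit (\<lambda>i. X i \<omega>) n - \<alpha>\<bar> \<le> \<eta>" if \<omega>: "\<omega> \<in> space M - (B1 \<union> B2 \<union> N)" for \<omega>
    proof -
      define x where "x = (\<lambda>i. X i \<omega>)"
      have ge1: "1 \<le> x i" if "i \<in> {1..n}" for i using \<omega> N(2) that by (auto simp: x_def)
      then have pos: "0 < x i" if "i \<in> {1..n}" for i using that by fastforce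
      define k where "k = kappa_star x n"
      have kin: "k \<in> {1..n-1}" unfolding k_def using n by (intro kappa_star_props) auto
      then have k: "1 \<le> k" "k \<le> n - 1" by auto
      obtain k' where "k' \<in> {1..n-1}" "KS_dist x n k' \<le> d"
        using B2(3)[of \<omega>] \<omega> pos by (auto simp: x_def)
      then have KS: "KS_dist x n k \<le> d"
        unfolding k_def using kappa_star_props(2)[of n k' x] n by auto
      \<comment> \<open>The jump bound turns a small distance into a large \<open>k\<close>.\<close>
      have "1 / (2 * real k) \<le> e / (4 * K)"
        using KS_dist_ge_jump[OF k, of x, OF pos] KS d(3) by linarith
      then have Kk: "2 * K / e \<le> real k" using k e K by (simp add: field_simps)
      define u where "u = order_stat x n (n - k)"
      have u: "1 \<le> u" unfolding u_def using k ge1 by (intro order_stat_ge) auto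
      have close: "uniformly_close G x n e K" unfolding x_def using \<omega> by (intro B1(3)) auto
      have "\<bar>alpha_hat x n k - \<alpha>\<bar> \<le> \<eta>"
      proof (rule \<delta>(2)[OF u])
        fix y :: real assume y: "1 \<le> y"
        have "\<bar>exceed x n (y * u) / real k - G (y * u) / G u\<bar> \<le> 4 * e"
          by (rule uniformly_close_ratio[OF close e(1,2) K(1) k Kk u_def _ y]) (use u in simp)
        moreover have "\<bar>exceed x n (y * u) / real k - y powr - alpha_hat x n k\<bar> \<le> KS_dist x n k"
          unfolding u_def using k pos y by (rule KS_dist_ge)
        ultimately show "\<bar>G (y * u) / G u - y powr - alpha_hat x n k\<bar> \<le> \<delta>"
          using KS d(2) e(3) by linarith
      qed
      then show ?thesis by (simp add: PLFit_def k_def x_def)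
    qed
    then have "{\<omega> \<in> space M. \<eta> < \<bar>PLFit (\<lambda>i. X i \<omega>) n - \<alpha>\<bar>} \<subseteq> B1 \<union> B2 \<union> N"
      by (force simp: not_less[symmetric])
    then have "prob {\<omega> \<in> space M. \<eta> < \<bar>PLFit (\<lambda>i. X i \<omega>) n - \<alpha>\<bar>} \<le> prob (B1 \<union> B2 \<union> N)"
      using B1 B2 N by (intro finite_measure_mono) auto
    also have "\<dots> = prob (B1 \<union> B2)"
      using B1 B2 N by (intro measure_Un_null_set) auto
    also have "\<dots> \<le> \<zeta>"
      using measure_Un_le[OF B1(1) B2(1)] B1(2) B2(2) by linarith
    finally show "prob {\<omega> \<in> space M. \<eta> < \<bar>PLFit (\<lambda>i. X i \<omega>) n - \<alpha>\<bar>} \<le> \<zeta>" .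
  qed
qed

lemma PLFit_consistent: "tendsto_in_probability M (\<lambda>n \<omega>. PLFit (\<lambda>i. X i \<omega>) n) \<alpha>"
  unfolding tendsto_in_probability_def
proof (intro conjI allI impI)
  show "eventually (\<lambda>n. (\<lambda>\<omega>. PLFit (\<lambda>i. X i \<omega>) n) \<in> borel_measurable M) sequentially"
    using eventually_ge_at_top[of 2] by eventually_elim (auto intro!: PLFit_measurable)
  fix \<eta> :: real assume \<eta>: "0 < \<eta>"
  show "(\<lambda>n. prob {\<omega> \<in> space M. \<bar>PLFit (\<lambda>i. X i \<omega>) n - \<alpha>\<bar> > \<eta>}) \<longlonglongrightarrow> 0"
  proof (rule LIMSEQ_I)
    fix \<zeta> :: real assume "0 < \<zeta>"
    then obtain n0 where n0: "\<And>n. n0 \<le> n \<Longrightarrow> prob {\<omega> \<in> space M. \<eta> < \<bar>PLFit (\<lambda>i. X i \<omega>) n - \<alpha>\<bar>} \<le> \<zeta> / 2"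
      using PLFit_deviation_prob[OF \<eta>, of "\<zeta> / 2"] by auto
    show "\<exists>n0. \<forall>n\<ge>n0. norm (prob {\<omega> \<in> space M. \<bar>PLFit (\<lambda>i. X i \<omega>) n - \<alpha>\<bar> > \<eta>} - 0) < \<zeta>"
    proof (intro exI allI impI)
      fix n assume "n0 \<le> n"
      then show "norm (prob {\<omega> \<in> space M. \<bar>PLFit (\<lambda>i. X i \<omega>) n - \<alpha>\<bar> > \<eta>} - 0) < \<zeta>"
        using n0[of n] \<open>0 < \<zeta>\<close> by simp
    qed
  qed
qed

end

theorem theorem1p1:
  fixes M :: "'a measure" and X :: "nat \<Rightarrow> 'a \<Rightarrow> real"
    and F :: "real \<Rightarrow> real" and \<alpha> :: real
  assumes "\<alpha> > 0"
    and "\<exists>\<mu>. real_distribution \<mu> \<and> F = cdf \<mu>"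
    and "\<And>x. x < 1 \<Longrightarrow> F x = 0"
    and "continuous_on UNIV F"
    and "regularly_varying (- \<alpha>) (\<lambda>x. 1 - F x)"
    and "continuous_on UNIV (\<lambda>x. 1 - F x)"
    and "continuous_on {0..<1} (quantile F)"
    and "prob_space M"
    and "prob_space.indep_vars M (\<lambda>_. borel) X {1..}"
    and "\<And>i. i \<ge> 1 \<Longrightarrow> cdf (distr M borel (X i)) = F"
  shows "tendsto_in_probability M (\<lambda>n \<omega>. PLFit (\<lambda>i. X i \<omega>) n) \<alpha>"
proof -
  obtain \<mu> where \<mu>: "real_distribution \<mu>" "F = cdf \<mu>" using assms(2) by blast
  interpret \<mu>: real_distribution \<mu> by fact
  interpret prob_space M by fact
  \<comment> \<open>Continuity extends the vanishing of \<open>F\<close> from below \<open>1\<close> to \<open>1\<close> itself.\<close>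
  have F_le_0: "F t = 0" if "t \<le> 1" for t
  proof -
    have "((\<lambda>x. F x) \<longlongrightarrow> F 1) (at_left 1)"
      using assms(4) by (auto simp: continuous_on_def intro: tendsto_within_subset)
    moreover have "eventually (\<lambda>x. F x = 0) (at_left (1::real))"
      using eventually_at_left_real[of 0 "1::real"] by (auto elim!: eventually_mono intro: assms(3))
    ultimately have "F 1 = 0"
      using tendsto_eventually tendsto_unique[OF trivial_limit_at_left_real] by blast
    then show ?thesis using assms(3)[of t] that by (cases "t = 1") auto
  qed
  have "rv_sample (\<lambda>t. 1 - F t) \<alpha> M X"
  proof
    show "0 < \<alpha>" by fact
    show "1 - F t \<le> 1 - F s" if "s \<le> t" for s t
      using \<mu>.cdf_nondecreasing[OF that] by (simp add: \<mu>(2))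
    show "continuous_on UNIV (\<lambda>t. 1 - F t)" by fact
    show "1 - F t = 1" if "t \<le> 1" for t using F_le_0[OF that] by simp
    show "((\<lambda>t. 1 - F t) \<longlongrightarrow> 0) at_top"
      using tendsto_diff[OF tendsto_const \<mu>.cdf_lim_at_top_prob, of 1] by (simp add: \<mu>(2))
    show "regularly_varying (- \<alpha>) (\<lambda>t. 1 - F t)" by fact
    show "indep_vars (\<lambda>_. borel) X {1..}" by fact
    fix i :: nat and t :: real assume i: "1 \<le> i"
    have X: "X i \<in> borel_measurable M" using assms(9) i by (simp add: indep_vars_def)
    have "F t = measure (distr M borel (X i)) {..t}" using assms(10)[OF i] by (simp add: cdf_def fun_eq_iff)
    also have "\<dots> = prob {\<omega> \<in> space M. X i \<omega> \<le> t}"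
      using X by (subst measure_distr) (auto simp: vimage_def Int_def conj_commute)
    finally have "F t = prob {\<omega> \<in> space M. X i \<omega> \<le> t}" .
    moreover have "{\<omega> \<in> space M. t < X i \<omega>} = space M - {\<omega> \<in> space M. X i \<omega> \<le> t}" by auto
    ultimately show "prob {\<omega> \<in> space M. t < X i \<omega>} = 1 - F t"
      using X by (simp add: prob_compl)
  qed
  then show ?thesis by (rule rv_sample.PLFit_consistent)
qed

end
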